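(* Every reflection graph is weakly norming. That is, for every finite reflection group $W\subset \mathbf{GL}(n,\mathbb{R})$, every set $S$ of simple reflections of $W$, and all subsets $S_1,S_2\subseteq S$, the $(S_1,S_2;S,W)$-reflection graph is weakly norming.
   Context: A finite reflection group is a finite subgroup $W$ of $\mathbf{GL}(n,\mathbb{R})$ generated by reflections across hyperplanes through the origin. Let $\Phi$ be the set of unit normal vectors (roots) of the reflecting hyperplanes of reflections in $W$ (two roots $\pm\alpha$ per hyperplane). Fixing an ordered basis $u_1,\dots,u_n$ of $\mathbb{R}^n$, a root $\alpha=\sum c_iu_i$ is positive if its first nonzero coefficient is positive; a simple system $\Delta$ is a minimal set of positive roots such that every positive root is a non-negative linear combination of elements of $\Delta$; the simple reflections are the reflections in the hyperplanes orthogonal to the elements of $\Delta$, and $S$ denotes the set of them. For $S_1,S_2\subseteq S$ let $W_i$ be the subgroup generated by $S_i$. The $(S_1,S_2;S,W)$-reflection graph is the bipartite graph with first part the set of left cosets of $W_1$ and second part the set of left cosets of $W_2$, in which $wW_1$ and $wW_2$ are adjacent for every $w\in W$ (and there are no other edges). For a bipartite graph $H$ with bipartition $(A,B)$ and bounded measurable $f:[0,1]^2\to\mathbb{R}$, $\|f\|_{r(H)}:=\left(\int\prod_{ij\in E(H), i\in A, j\in B}|f(x_i,x_j)|\,d\mu^{|V(H)|}\right)^{1/|E(H)|}$ with $\mu$ Lebesgue measure; $H$ is weakly norming if $\|\cdot\|_{r(H)}$ is a norm on bounded measurable functions on $[0,1]^2$. *)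

theory Defs
  imports "HOL-Analysis.Analysis" "HOL-Algebra.Generated_Groups" "HOL-Algebra.Left_Coset"
begin

definition GL :: "(real ^ 'n ^ 'n) monoid" where
  "GL = \<lparr>carrier = {A. invertible A}, mult = (**), one = mat 1\<rparr>"

text \<open>The orthogonal reflection across the hyperplane through the origin with normal vector
  \<open>\<alpha>\<close>; it is a reflection only for \<open>\<alpha> \<noteq> 0\<close>.\<close>

definition reflection :: "real ^ 'n \<Rightarrow> real ^ 'n ^ 'n" where
  "reflection \<alpha> = matrix (\<lambda>v. v - (2 * (v \<bullet> \<alpha>) / (\<alpha> \<bullet> \<alpha>)) *\<^sub>R \<alpha>)"

definition reflections :: "(real ^ 'n ^ 'n) set" where
  "reflections = reflection ` {\<alpha>. \<alpha> \<noteq> 0}"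

definition finite_reflection_group :: "(real ^ 'n ^ 'n) set \<Rightarrow> bool" where
  "finite_reflection_group W \<longleftrightarrow>
     subgroup W GL \<and> finite W \<and> (\<exists>R \<subseteq> reflections. W = generate GL R)"

definition roots :: "(real ^ 'n ^ 'n) set \<Rightarrow> (real ^ 'n) set" where
  "roots W = {\<alpha>. norm \<alpha> = 1 \<and> reflection \<alpha> \<in> W}"

definition ordered_basis :: "(real ^ 'n) list \<Rightarrow> bool" where
  "ordered_basis u \<longleftrightarrow> distinct u \<and> independent (set u) \<and> span (set u) = UNIV"

definition lex_positive :: "(real ^ 'n) list \<Rightarrow> real ^ 'n \<Rightarrow> bool" where
  "lex_positive u \<alpha> \<longleftrightarrow>
     (\<exists>c :: nat \<Rightarrow> real. \<alpha> = (\<Sum>i<length u. c i *\<^sub>R u ! i) \<and>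
        (\<exists>k<length u. c k > 0 \<and> (\<forall>i<k. c i = 0)))"

definition positive_roots ::
  "(real ^ 'n) list \<Rightarrow> (real ^ 'n ^ 'n) set \<Rightarrow> (real ^ 'n) set" where
  "positive_roots u W = {\<alpha> \<in> roots W. lex_positive u \<alpha>}"

definition nonneg_generating :: "(real ^ 'n) set \<Rightarrow> (real ^ 'n) set \<Rightarrow> bool" where
  "nonneg_generating P \<Delta> \<longleftrightarrow> \<Delta> \<subseteq> P \<and>
     (\<forall>\<beta>\<in>P. \<exists>a :: real ^ 'n \<Rightarrow> real.
        (\<forall>\<alpha>\<in>\<Delta>. 0 \<le> a \<alpha>) \<and> \<beta> = (\<Sum>\<alpha>\<in>\<Delta>. a \<alpha> *\<^sub>R \<alpha>))"

definition simple_system :: "(real ^ 'n ^ 'n) set \<Rightarrow> (real ^ 'n) set \<Rightarrow> bool" where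
  "simple_system W \<Delta> \<longleftrightarrow>
     (\<exists>u. ordered_basis u \<and> nonneg_generating (positive_roots u W) \<Delta> \<and>
        (\<forall>\<Delta>'. \<Delta>' \<subset> \<Delta> \<longrightarrow> \<not> nonneg_generating (positive_roots u W) \<Delta>'))"

definition simple_reflections :: "(real ^ 'n ^ 'n) set \<Rightarrow> (real ^ 'n ^ 'n) set \<Rightarrow> bool" where
  "simple_reflections W S \<longleftrightarrow> (\<exists>\<Delta>. simple_system W \<Delta> \<and> S = reflection ` \<Delta>)"

text \<open>The two parts may have the same type and may even overlap as sets (as they do for
  \<open>W\<^sub>1 = W\<^sub>2\<close>); the vertex set of the graph is their disjoint sum.\<close>

record ('a, 'b) bigraph =
  left_part :: "'a set"
  right_part :: "'b set"
  edge_set :: "('a \<times> 'b) set"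

definition finite_bigraph :: "('a, 'b) bigraph \<Rightarrow> bool" where
  "finite_bigraph H \<longleftrightarrow> finite (left_part H) \<and> finite (right_part H) \<and>
     edge_set H \<subseteq> left_part H \<times> right_part H"

definition vertex_set :: "('a, 'b) bigraph \<Rightarrow> ('a + 'b) set" where
  "vertex_set H = left_part H <+> right_part H"

definition reflection_graph ::
  "(real ^ 'n ^ 'n) set \<Rightarrow> (real ^ 'n ^ 'n) set \<Rightarrow> (real ^ 'n ^ 'n) set \<Rightarrow>
     ((real ^ 'n ^ 'n) set, (real ^ 'n ^ 'n) set) bigraph" where
  "reflection_graph W S1 S2 =
     (let G = GL\<lparr>carrier := W\<rparr>; W1 = generate G S1; W2 = generate G S2 in
      \<lparr>left_part = lcosets\<^bsub>G\<^esub> W1, right_part = lcosets\<^bsub>G\<^esub> W2,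
       edge_set = (\<lambda>w. (w <#\<^bsub>G\<^esub> W1, w <#\<^bsub>G\<^esub> W2)) ` W\<rparr>)"

definition bounded_measurable :: "(real \<times> real \<Rightarrow> real) set" where
  "bounded_measurable =
     {f. f \<in> borel_measurable (lebesgue_on ({0..1} \<times> {0..1})) \<and>
         bounded (f ` ({0..1} \<times> {0..1}))}"

text \<open>Lebesgue measure on \<open>[0,1]\<^sup>V\<close>. The completion is needed because \<open>f (x i, x j)\<close> is in
  general not measurable for the product sigma-algebra if \<open>f\<close> is only Lebesgue measurable.\<close>

definition cube_measure :: "'v set \<Rightarrow> ('v \<Rightarrow> real) measure" where
  "cube_measure V = completion (PiM V (\<lambda>_. restrict_space lborel {0..1}))"

definition r_norm :: "('a, 'b) bigraph \<Rightarrow> (real \<times> real \<Rightarrow> real) \<Rightarrow> real" where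
  "r_norm H f =
     (\<integral>x. (\<Prod>(i, j)\<in>edge_set H. \<bar>f (x (Inl i), x (Inr j))\<bar>) \<partial>cube_measure (vertex_set H))
       powr (1 / real (card (edge_set H)))"

text \<open>A norm on bounded measurable functions, where, as usual, functions that agree almost
  everywhere are identified.\<close>

definition norm_on_bounded_measurable :: "((real \<times> real \<Rightarrow> real) \<Rightarrow> real) \<Rightarrow> bool" where
  "norm_on_bounded_measurable N \<longleftrightarrow>
     (\<forall>f\<in>bounded_measurable. 0 \<le> N f) \<and>
     (\<forall>f\<in>bounded_measurable.
        N f = 0 \<longleftrightarrow> (AE z in lebesgue_on ({0..1} \<times> {0..1}). f z = 0)) \<and>
     (\<forall>f\<in>bounded_measurable. \<forall>c. N (\<lambda>z. c * f z) = \<bar>c\<bar> * N f) \<and>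
     (\<forall>f\<in>bounded_measurable. \<forall>g\<in>bounded_measurable. N (\<lambda>z. f z + g z) \<le> N f + N g)"

definition weakly_norming :: "('a, 'b) bigraph \<Rightarrow> bool" where
  "weakly_norming H \<longleftrightarrow> finite_bigraph H \<and> norm_on_bounded_measurable (r_norm H)"

end

theory Submission
  imports Defs "HOL-Probability.Infinite_Product_Measure"
begin

text \<open>Assign one of two functions to every edge by a colouring. The weak norm property follows from a
  Hoelder inequality: if both monochromatic integrals are at most 1, so are all coloured ones.
  A reflection \<open>s\<close> in \<open>W\<close> acts on the graph; its hyperplane cuts the non-fixed vertices into two
  halves with no edge between them, so Cauchy-Schwarz over the fixed vertices bounds the square of a
  coloured integral by the product of the two integrals in which one half is replaced by the
  mirror image of the other. Hence folding a colouring of maximal integral keeps it maximal. Folding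
  towards the fundamental chamber across simple hyperplanes shortens group elements, and a suitable
  sequence of such folds sends every element of \<open>W\<close> to 1: it turns every colouring into a
  monochromatic one. That the halves are well defined on cosets needs no geometry: an element of
  \<open>W\<^sub>i\<close> permutes the positive roots whose reflections lie outside \<open>W\<^sub>i\<close>.\<close>

section \<open>Cauchy-Schwarz for folds\<close>

text \<open>Two colours suffice because the triangle inequality has two summands: expanding the
  product of \<open>F + G\<close> over the edges gives one coloured integral for each set of edges,
  and the bounds for these add up binomially. Working with a maximal colouring spares the count of
  how often a fold repeats each edge, which reading exponents off iterated Cauchy-Schwarz would
  require. The price is that the maximum has to be finite, hence the bounds on the functions. The
  obstacle is a hyperplane that meets a coset \<open>w H\<close>. The reflection \<open>s\<close>
  fixes \<open>w H\<close> exactly if \<open>w^-1 s w\<close>, the reflection in the root w^-1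
  \<alpha>, lies in \<open>H\<close>; otherwise \<open>H\<close> cannot change the sign of that
  root. So a coset lies on the mirror or strictly on one side. An edge cannot cross because both its
  ends are cosets of one and the same \<open>w\<close>. \<open>edge_integral\<close> gives every
  edge its own function and separates edges from their ends, so that a fold is merely a map on
  edges; values in \<open>ennreal\<close> avoid integrability conditions.\<close>

definition edge_integral ::
  "'s measure \<Rightarrow> 'v set \<Rightarrow> 'e set \<Rightarrow> ('e \<Rightarrow> 'v) \<Rightarrow> ('e \<Rightarrow> 'v) \<Rightarrow> ('e \<Rightarrow> 's \<times> 's \<Rightarrow> ennreal) \<Rightarrow> ennreal"
  where "edge_integral M V E p q u = (\<integral>\<^sup>+x. (\<Prod>e\<in>E. u e (x (p e), x (q e))) \<partial>PiM V (\<lambda>_. M))"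

text \<open>Coordinates outside the image of \<open>f\<close> have total mass 1, so the pushforward
  along \<open>f\<close> is again a product measure. It is applied with \<open>f\<close> =
  \<open>\<sigma>\<close>, to integrate over the mirror image of \<open>L\<close> in the coordinates
  of \<open>L\<close>.\<close>

lemma nn_integral_PiM_reindex:
  assumes "prob_space M" "inj_on f I" "f \<in> I \<rightarrow> K" "h \<in> borel_measurable (PiM I (\<lambda>_. M))"
  shows "(\<integral>\<^sup>+x. h (\<lambda>i\<in>I. x (f i)) \<partial>PiM K (\<lambda>_. M)) = (\<integral>\<^sup>+x. h x \<partial>PiM I (\<lambda>_. M))"
proof -
  have [measurable]: "(\<lambda>x. \<lambda>i\<in>I. x (f i)) \<in> PiM K (\<lambda>_. M) \<rightarrow>\<^sub>M PiM I (\<lambda>_. M)"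
    using assms(3) by (intro measurable_restrict measurable_component_singleton) auto
  have "(\<integral>\<^sup>+x. h x \<partial>PiM I (\<lambda>_. M)) = (\<integral>\<^sup>+x. h x \<partial>distr (PiM K (\<lambda>_. M)) (PiM I (\<lambda>_. M)) (\<lambda>x. \<lambda>i\<in>I. x (f i)))"
    using distr_PiM_reindex[of K "\<lambda>_. M" f I] assms by simp
  also have "\<dots> = (\<integral>\<^sup>+x. h (\<lambda>i\<in>I. x (f i)) \<partial>PiM K (\<lambda>_. M))"
    using assms(4) by (subst nn_integral_distr) auto
  finally show ?thesis by simp
qed

text \<open>Once the coordinates in \<open>F\<close> are fixed, \<open>A\<close> sees only
  \<open>L\<close> and \<open>B\<close> only the mirror image of \<open>L\<close>, which are
  independent, so Fubini factors the integral. Renaming by \<open>\<sigma>\<close> makes both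
  factors integrals over the same \<open>L\<close>.\<close>

lemma reflected_integral_split:
  fixes M :: "'s measure" and \<sigma> :: "'v \<Rightarrow> 'v"
  assumes M: "prob_space M" and fin: "finite F" "finite L"
    and disj: "F \<inter> L = {}" "F \<inter> \<sigma> ` L = {}" "L \<inter> \<sigma> ` L = {}"
    and \<sigma>: "\<And>v. v \<in> L \<Longrightarrow> \<sigma> (\<sigma> v) = v" "\<And>v. v \<in> F \<Longrightarrow> \<sigma> v = v"
    and G[measurable]: "G \<in> borel_measurable (PiM F (\<lambda>_. M))"
    and A[measurable]: "A \<in> borel_measurable (PiM (F \<union> L) (\<lambda>_. M))"
    and B[measurable]: "B \<in> borel_measurable (PiM (F \<union> L) (\<lambda>_. M))"
  shows "(\<integral>\<^sup>+x. G (restrict x F) * (A (restrict x (F \<union> L)) * B (restrict (x \<circ> \<sigma>) (F \<union> L)))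
            \<partial>PiM (F \<union> (L \<union> \<sigma> ` L)) (\<lambda>_. M)) =
         (\<integral>\<^sup>+z. G z * ((\<integral>\<^sup>+x. A (merge F L (z, x)) \<partial>PiM L (\<lambda>_. M)) *
            (\<integral>\<^sup>+x. B (merge F L (z, x)) \<partial>PiM L (\<lambda>_. M))) \<partial>PiM F (\<lambda>_. M))"
proof -
  interpret M: prob_space M by fact
  interpret product_sigma_finite "\<lambda>_::'v. M" by unfold_locales
  let ?R = "\<sigma> ` L"
  let ?P = "\<lambda>I. PiM I (\<lambda>_::'v. M)"
  let ?h = "\<lambda>x. G (restrict x F) * (A (restrict x (F \<union> L)) * B (restrict (x \<circ> \<sigma>) (F \<union> L)))"
  have [measurable]: "(\<lambda>x. restrict (x \<circ> \<sigma>) (F \<union> L)) \<in> ?P (F \<union> (L \<union> ?R)) \<rightarrow>\<^sub>M ?P (F \<union> L)"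
    unfolding comp_def using \<sigma>
    by (intro measurable_restrict measurable_component_singleton) auto
  have [measurable]: "(\<lambda>x. restrict x F) \<in> ?P (F \<union> (L \<union> ?R)) \<rightarrow>\<^sub>M ?P F"
    "(\<lambda>x. restrict x (F \<union> L)) \<in> ?P (F \<union> (L \<union> ?R)) \<rightarrow>\<^sub>M ?P (F \<union> L)"
    by (auto intro!: measurable_restrict_subset)
  have h[measurable]: "?h \<in> borel_measurable (?P (F \<union> (L \<union> ?R)))"
    by measurable
  \<comment> \<open>The point \<open>y\<close> is written onto the mirror image through
    \<open>\<sigma>\<close>; since \<open>\<sigma>\<close> is an involution, \<open>B\<close>, which
    reads through \<open>\<sigma>\<close>, gets \<open>y\<close> itself back.\<close>
  have eq: "?h (merge F (L \<union> ?R) (z, merge L ?R (x, \<lambda>r\<in>?R. y (\<sigma> r)))) =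
      G z * (A (merge F L (z, x)) * B (merge F L (z, y)))"
    if "z \<in> space (?P F)" "x \<in> space (?P L)" "y \<in> space (?P L)" for x y z
  proof -
    let ?m = "merge F (L \<union> ?R) (z, merge L ?R (x, \<lambda>r\<in>?R. y (\<sigma> r)))"
    have "restrict ?m F = z"
      using that disj by (auto simp: space_PiM fun_eq_iff merge_def PiE_def extensional_def)
    moreover have "restrict ?m (F \<union> L) = merge F L (z, x)"
      using disj by (auto simp: fun_eq_iff merge_def)
    moreover have "restrict (?m \<circ> \<sigma>) (F \<union> L) = merge F L (z, y)"
      using disj \<sigma> by (auto simp: fun_eq_iff merge_def)
    ultimately show ?thesis by simp
  qed
  have inner: "(\<integral>\<^sup>+w. ?h (merge F (L \<union> ?R) (z, w)) \<partial>?P (L \<union> ?R)) =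
      G z * ((\<integral>\<^sup>+x. A (merge F L (z, x)) \<partial>?P L) * (\<integral>\<^sup>+x. B (merge F L (z, x)) \<partial>?P L))"
    if z: "z \<in> space (?P F)" for z
  proof -
    have [measurable]: "(\<lambda>w. merge F (L \<union> ?R) (z, w)) \<in> ?P (L \<union> ?R) \<rightarrow>\<^sub>M ?P (F \<union> (L \<union> ?R))"
      "(\<lambda>w. merge F L (z, w)) \<in> ?P L \<rightarrow>\<^sub>M ?P (F \<union> L)"
      using z by measurable
    have "(\<integral>\<^sup>+w. ?h (merge F (L \<union> ?R) (z, w)) \<partial>?P (L \<union> ?R)) =
      (\<integral>\<^sup>+x. (\<integral>\<^sup>+y. ?h (merge F (L \<union> ?R) (z, merge L ?R (x, y))) \<partial>?P ?R) \<partial>?P L)"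
      using disj fin by (intro product_nn_integral_fold) auto
    also have "\<dots> = (\<integral>\<^sup>+x. (\<integral>\<^sup>+y. ?h (merge F (L \<union> ?R) (z, merge L ?R (x, \<lambda>r\<in>?R. y (\<sigma> r)))) \<partial>?P L) \<partial>?P L)"
    proof (rule nn_integral_cong)
      fix x assume x: "x \<in> space (?P L)"
      then have [measurable]: "(\<lambda>y. merge L ?R (x, y)) \<in> ?P ?R \<rightarrow>\<^sub>M ?P (L \<union> ?R)"
        by measurable
      show "(\<integral>\<^sup>+y. ?h (merge F (L \<union> ?R) (z, merge L ?R (x, y))) \<partial>?P ?R) =
         (\<integral>\<^sup>+y. ?h (merge F (L \<union> ?R) (z, merge L ?R (x, \<lambda>r\<in>?R. y (\<sigma> r)))) \<partial>?P L)"
        using \<sigma> by (intro nn_integral_PiM_reindex[symmetric, of M \<sigma> ?R L] M)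
          (auto simp: inj_on_def)
    qed
    also have "\<dots> = (\<integral>\<^sup>+x. (\<integral>\<^sup>+y. G z * (A (merge F L (z, x)) * B (merge F L (z, y))) \<partial>?P L) \<partial>?P L)"
      using z by (intro nn_integral_cong eq)
    also have "\<dots> = G z * ((\<integral>\<^sup>+x. A (merge F L (z, x)) \<partial>?P L) * (\<integral>\<^sup>+x. B (merge F L (z, x)) \<partial>?P L))"
      by (simp add: nn_integral_cmult nn_integral_multc)
    finally show ?thesis .
  qed
  have "(\<integral>\<^sup>+x. ?h x \<partial>?P (F \<union> (L \<union> ?R))) =
      (\<integral>\<^sup>+z. (\<integral>\<^sup>+w. ?h (merge F (L \<union> ?R) (z, w)) \<partial>?P (L \<union> ?R)) \<partial>?P F)"
    using disj fin by (intro product_nn_integral_fold) auto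
  also have "\<dots> = (\<integral>\<^sup>+z. G z * ((\<integral>\<^sup>+x. A (merge F L (z, x)) \<partial>?P L) * (\<integral>\<^sup>+x. B (merge F L (z, x)) \<partial>?P L)) \<partial>?P F)"
    by (intro nn_integral_cong inner)
  finally show ?thesis .
qed

text \<open>Both sides of the mirror contribute functions of the coordinates in \<open>F \<union> L\<close>: the far side is
  read through \<open>\<sigma>\<close>. Integrating out \<open>L\<close> and its mirror image separately leaves a product of two
  functions on \<open>F\<close>.\<close>

lemma reflected_Cauchy_Schwarz:
  fixes M :: "'s measure" and \<sigma> :: "'v \<Rightarrow> 'v"
  assumes M: "prob_space M" and fin: "finite F" "finite L"
    and disj: "F \<inter> L = {}" "F \<inter> \<sigma> ` L = {}" "L \<inter> \<sigma> ` L = {}"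
    and \<sigma>: "\<And>v. v \<in> L \<Longrightarrow> \<sigma> (\<sigma> v) = v" "\<And>v. v \<in> F \<Longrightarrow> \<sigma> v = v"
    and G[measurable]: "G \<in> borel_measurable (PiM F (\<lambda>_. M))"
    and A[measurable]: "A \<in> borel_measurable (PiM (F \<union> L) (\<lambda>_. M))"
    and B[measurable]: "B \<in> borel_measurable (PiM (F \<union> L) (\<lambda>_. M))"
  defines "I \<equiv> \<lambda>A B. \<integral>\<^sup>+x. G (restrict x F) * (A (restrict x (F \<union> L)) * B (restrict (x \<circ> \<sigma>) (F \<union> L)))
            \<partial>PiM (F \<union> (L \<union> \<sigma> ` L)) (\<lambda>_. M)"
  shows "(I A B)\<^sup>2 \<le> I A A * I B B"
proof -
  interpret M: prob_space M by fact
  interpret product_sigma_finite "\<lambda>_::'v. M" by unfold_locales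
  interpret L: finite_product_sigma_finite "\<lambda>_::'v. M" L by unfold_locales fact
  let ?P = "\<lambda>I. PiM I (\<lambda>_::'v. M)"
  define a where "a A z = (\<integral>\<^sup>+x. A (merge F L (z, x)) \<partial>?P L)" for A :: "('v \<Rightarrow> 's) \<Rightarrow> ennreal" and z
  have meas: "a A \<in> borel_measurable (?P F)" if [measurable]: "A \<in> borel_measurable (?P (F \<union> L))" for A
    unfolding a_def by measurable
  have [measurable]: "a A \<in> borel_measurable (?P F)" "a B \<in> borel_measurable (?P F)"
    using meas by auto
  \<comment> \<open>The weight \<open>G\<close> becomes the density of the measure, so the ordinary
    Cauchy-Schwarz inequality applies to the two marginals.\<close>
  have eq: "I A' B' = (\<integral>\<^sup>+z. a A' z * a B' z \<partial>density (?P F) G)"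
    if [measurable]: "A' \<in> borel_measurable (?P (F \<union> L))" "B' \<in> borel_measurable (?P (F \<union> L))" for A' B'
  proof -
    have [measurable]: "a A' \<in> borel_measurable (?P F)" "a B' \<in> borel_measurable (?P F)"
      using that meas by auto
    have "I A' B' = (\<integral>\<^sup>+z. G z * (a A' z * a B' z) \<partial>?P F)"
      unfolding I_def a_def by (intro reflected_integral_split assms that) auto
    then show ?thesis by (simp add: nn_integral_density)
  qed
  show ?thesis
    using Cauchy_Schwarz_nn_integral[of "a A" "density (?P F) G" "a B"]
    by (simp add: eq power2_eq_square)
qed

text \<open>\<open>EF\<close> holds the edges inside the mirror, \<open>EL\<close> those of one
  side, and \<open>\<tau>\<close> is the reflection on edges. The integrand splits into these three
  products, which is the shape of \<open>reflected_Cauchy_Schwarz\<close>. On the right, the first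
  factor copies the functions of \<open>EL\<close> to the other side and the second copies them the
  other way.\<close>

lemma edge_integral_fold:
  fixes M :: "'s measure" and \<sigma> :: "'v \<Rightarrow> 'v" and p q :: "'e \<Rightarrow> 'v"
  assumes M: "prob_space M" and fin: "finite V" "finite E"
    and V: "V = F \<union> (L \<union> \<sigma> ` L)" 
    and disj: "F \<inter> L = {}" "F \<inter> \<sigma> ` L = {}" "L \<inter> \<sigma> ` L = {}"
    and \<sigma>: "\<And>v. v \<in> L \<Longrightarrow> \<sigma> (\<sigma> v) = v" "\<And>v. v \<in> F \<Longrightarrow> \<sigma> v = v"
    and E: "E = EF \<union> (EL \<union> \<tau> ` EL)"
    and disjE: "EF \<inter> EL = {}" "EF \<inter> \<tau> ` EL = {}" "EL \<inter> \<tau> ` EL = {}"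
    and \<tau>: "\<And>e. e \<in> EL \<Longrightarrow> \<tau> (\<tau> e) = e"
      "\<And>e. e \<in> EL \<Longrightarrow> p (\<tau> e) = \<sigma> (p e)" "\<And>e. e \<in> EL \<Longrightarrow> q (\<tau> e) = \<sigma> (q e)"
    and ends: "p ` EF \<subseteq> F" "q ` EF \<subseteq> F" "p ` EL \<subseteq> F \<union> L" "q ` EL \<subseteq> F \<union> L"
    and u: "\<And>e. e \<in> E \<Longrightarrow> u e \<in> borel_measurable (M \<Otimes>\<^sub>M M)"
  shows "(edge_integral M V E p q u)\<^sup>2 \<le>
    edge_integral M V E p q (\<lambda>e. u (if e \<in> \<tau> ` EL then \<tau> e else e)) *
    edge_integral M V E p q (\<lambda>e. u (if e \<in> EL then \<tau> e else e))"
proof -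
  have finL: "finite F" "finite L" "finite EF" "finite EL"
    using fin V E by auto
  define G where "G x = (\<Prod>e\<in>EF. u e (x (p e), x (q e)))" for x
  define A where "A k x = (\<Prod>e\<in>EL. u (k e) (x (p e), x (q e)))" for k :: "'e \<Rightarrow> 'e" and x
  define I where "I A B = (\<integral>\<^sup>+x. G (restrict x F) * (A (restrict x (F \<union> L)) * B (restrict (x \<circ> \<sigma>) (F \<union> L)))
            \<partial>PiM (F \<union> (L \<union> \<sigma> ` L)) (\<lambda>_. M))" for A B
  have meas: "(\<lambda>x. u e (x i, x j)) \<in> borel_measurable (PiM J (\<lambda>_. M))"
    if "e \<in> E" "i \<in> J" "j \<in> J" for e i j J
    by (rule measurable_compose[OF _ u[OF that(1)]])
      (intro measurable_Pair measurable_component_singleton that)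
  have G: "G \<in> borel_measurable (PiM F (\<lambda>_. M))"
    unfolding G_def using ends E by (intro borel_measurable_prod_ennreal meas) auto
  have A: "A k \<in> borel_measurable (PiM (F \<union> L) (\<lambda>_. M))" if "k ` EL \<subseteq> E" for k
    unfolding A_def using ends that by (intro borel_measurable_prod_ennreal meas) auto
  have inj: "inj_on \<tau> EL"
    using \<tau>(1) by (metis inj_onI)
  \<comment> \<open>One formula for all three integrals: \<open>k\<close> tells from which edge the
    function is taken, and it is \<open>id\<close> or one of the two folds. Edges inside the mirror
    keep their functions, so \<open>G\<close> is common to all.\<close>
  have main: "edge_integral M V E p q (\<lambda>e. u (k e)) = I (A k) (A (k \<circ> \<tau>))"
    if k: "\<And>e. e \<in> EF \<Longrightarrow> k e = e" for k
  proof -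
    have "(\<Prod>e\<in>E. u (k e) (x (p e), x (q e))) =
       G (restrict x F) * (A k (restrict x (F \<union> L)) * A (k \<circ> \<tau>) (restrict (x \<circ> \<sigma>) (F \<union> L)))" for x
    proof -
      have "(\<Prod>e\<in>E. u (k e) (x (p e), x (q e))) = (\<Prod>e\<in>EF. u (k e) (x (p e), x (q e))) *
         ((\<Prod>e\<in>EL. u (k e) (x (p e), x (q e))) * (\<Prod>e\<in>\<tau> ` EL. u (k e) (x (p e), x (q e))))"
        unfolding E using disjE finL
        by (subst prod.union_disjoint; (subst prod.union_disjoint)?) auto
      moreover have "(\<Prod>e\<in>EF. u (k e) (x (p e), x (q e))) = G (restrict x F)"
        unfolding G_def using ends k by (intro prod.cong) auto
      moreover have "(\<Prod>e\<in>EL. u (k e) (x (p e), x (q e))) = A k (restrict x (F \<union> L))"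
        unfolding A_def using ends by (intro prod.cong) auto
      moreover have "(\<Prod>e\<in>\<tau> ` EL. u (k e) (x (p e), x (q e))) = A (k \<circ> \<tau>) (restrict (x \<circ> \<sigma>) (F \<union> L))"
        unfolding A_def prod.reindex[OF inj] using ends \<tau> by (intro prod.cong) auto
      ultimately show ?thesis by simp
    qed
    then show ?thesis
      unfolding edge_integral_def I_def V by simp
  qed
  let ?k1 = "\<lambda>e. if e \<in> \<tau> ` EL then \<tau> e else e" and ?k2 = "\<lambda>e. if e \<in> EL then \<tau> e else e"
  have "\<tau> e \<notin> EL" if "e \<in> EL" for e
    using disjE(3) that by blast
  then have "A ?k1 = A id" "A (?k1 \<circ> \<tau>) = A id" "A ?k2 = A \<tau>" "A (?k2 \<circ> \<tau>) = A \<tau>"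
    unfolding A_def using disjE \<tau>(1) by (auto intro!: ext prod.cong)
  then have "edge_integral M V E p q (\<lambda>e. u (?k1 e)) = I (A id) (A id)"
    "edge_integral M V E p q (\<lambda>e. u (?k2 e)) = I (A \<tau>) (A \<tau>)"
    "edge_integral M V E p q u = I (A id) (A \<tau>)"
    using main[of ?k1] main[of ?k2] main[of id] disjE by (auto simp: disjoint_iff)
  moreover have "(I (A id) (A \<tau>))\<^sup>2 \<le> I (A id) (A id) * I (A \<tau>) (A \<tau>)"
    unfolding I_def using disj \<sigma> E
    by (intro reflected_Cauchy_Schwarz[OF M finL(1,2)] G A) auto
  ultimately show ?thesis by simp
qed

section \<open>The Hoelder inequality for edge colourings\<close>

text \<open>Reindexing along \<open>bool\<close> reduces the two-point marginal to the known
  description of a binary product. It carries integrals and null sets of a single edge from the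
  square to the cube.\<close>

lemma distr_PiM_pair:
  assumes M: "prob_space M" and ij: "i \<in> V" "j \<in> V" "i \<noteq> j"
  shows "distr (PiM V (\<lambda>_. M)) (M \<Otimes>\<^sub>M M) (\<lambda>x. (x i, x j)) = M \<Otimes>\<^sub>M M"
proof -
  interpret M: prob_space M by fact
  let ?f = "\<lambda>b. if b then i else j"
  let ?B = "PiM UNIV (\<lambda>_::bool. M)"
  have cb: "case_bool M M = (\<lambda>_. M)" by (auto split: bool.split)
  have "M \<Otimes>\<^sub>M M = distr ?B (M \<Otimes>\<^sub>M M) (\<lambda>x. (x True, x False))"
    using pair_measure_eq_distr_PiM[of M M] M.sigma_finite_measure_axioms by (simp add: cb)
  also have "?B = distr (PiM V (\<lambda>_. M)) ?B (\<lambda>x. \<lambda>b\<in>UNIV. x (?f b))"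
    using ij M by (intro distr_PiM_reindex[symmetric, of V "\<lambda>_. M" ?f UNIV]) (auto simp: inj_on_def)
  also have "distr \<dots> (M \<Otimes>\<^sub>M M) (\<lambda>x. (x True, x False)) = distr (PiM V (\<lambda>_. M)) (M \<Otimes>\<^sub>M M) (\<lambda>x. (x i, x j))"
    using ij by (subst distr_distr) (auto simp: comp_def intro!: measurable_restrict)
  finally show ?thesis by simp
qed

text \<open>What remains of a fold once the geometry is forgotten: two maps on edges, one for each
  half that is copied onto the other.\<close>

definition Cauchy_Schwarz_pair ::
  "'s measure \<Rightarrow> 'v set \<Rightarrow> 'e set \<Rightarrow> ('e \<Rightarrow> 'v) \<Rightarrow> ('e \<Rightarrow> 'v) \<Rightarrow> ('e \<Rightarrow> 'e) \<Rightarrow> ('e \<Rightarrow> 'e) \<Rightarrow> bool"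
  where "Cauchy_Schwarz_pair M V E p q \<phi> \<phi>' \<longleftrightarrow> \<phi> ` E \<subseteq> E \<and> \<phi>' ` E \<subseteq> E \<and>
    (\<forall>u. (\<forall>e\<in>E. u e \<in> borel_measurable (M \<Otimes>\<^sub>M M)) \<longrightarrow>
      (edge_integral M V E p q u)\<^sup>2 \<le> edge_integral M V E p q (u \<circ> \<phi>) * edge_integral M V E p q (u \<circ> \<phi>'))"

text \<open>The Hoelder inequality in normalised form; scaling would give the form with exponents.
  The normalisation avoids roots and vanishing norms, and the bound \<open>K\<close> keeps every
  coloured integral finite.\<close>

definition edge_Hoelder ::
  "'s measure \<Rightarrow> 'v set \<Rightarrow> 'e set \<Rightarrow> ('e \<Rightarrow> 'v) \<Rightarrow> ('e \<Rightarrow> 'v) \<Rightarrow> bool"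
  where "edge_Hoelder M V E p q \<longleftrightarrow>
    (\<forall>f :: bool \<Rightarrow> 's \<times> 's \<Rightarrow> ennreal. \<forall>K :: real. (\<forall>c. f c \<in> borel_measurable (M \<Otimes>\<^sub>M M)) \<longrightarrow>
      (\<forall>c z. f c z \<le> ennreal K) \<longrightarrow> (\<forall>c. edge_integral M V E p q (\<lambda>_. f c) \<le> 1) \<longrightarrow>
      (\<forall>\<kappa>. edge_integral M V E p q (\<lambda>e. f (\<kappa> e)) \<le> 1))"

lemma edge_integral_cong:
  "(\<And>e. e \<in> E \<Longrightarrow> u e = v e) \<Longrightarrow> edge_integral M V E p q u = edge_integral M V E p q v"
  unfolding edge_integral_def by (intro nn_integral_cong prod.cong) auto

lemma edge_integral_le:
  assumes "prob_space M" "\<And>e z. e \<in> E \<Longrightarrow> u e z \<le> K"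
  shows "edge_integral M V E p q u \<le> K ^ card E"
proof -
  interpret P: prob_space "PiM V (\<lambda>_. M)"
    using assms(1) by (intro prob_space_PiM)
  have "(\<Prod>e\<in>E. v e) \<le> K ^ card E" if "\<And>e. e \<in> E \<Longrightarrow> v e \<le> K" for v :: "'b \<Rightarrow> ennreal"
    using that by (induction E rule: infinite_finite_induct) (auto intro!: mult_mono)
  then have "edge_integral M V E p q u \<le> (\<integral>\<^sup>+x. K ^ card E \<partial>PiM V (\<lambda>_. M))"
    unfolding edge_integral_def using assms(2)
    by (intro nn_integral_mono) auto
  then show ?thesis
    by (simp add: P.emeasure_space_1)
qed

text \<open>The folds carry a maximal colouring to one that gives every edge the colour of
  \<open>e0\<close>, so the maximum over all colourings is itself a monochromatic integral and hence
  at most 1.\<close>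

lemma edge_Hoelder_if_constant_fold:
  fixes \<phi>s :: "('e \<Rightarrow> 'e) list"
  assumes M: "prob_space M" and E: "finite E"
    and \<phi>s: "\<And>\<phi>. \<phi> \<in> set \<phi>s \<Longrightarrow> \<exists>\<phi>'. Cauchy_Schwarz_pair M V E p q \<phi> \<phi>'"
    and const: "\<And>e. e \<in> E \<Longrightarrow> foldr (\<lambda>\<phi>. \<phi>) \<phi>s e = e0"
  shows "edge_Hoelder M V E p q"
  unfolding edge_Hoelder_def
proof (intro allI impI)
  fix f :: "bool \<Rightarrow> 'a \<times> 'a \<Rightarrow> ennreal" and K :: real and \<kappa> :: "'e \<Rightarrow> bool"
  assume f: "\<forall>c. f c \<in> borel_measurable (M \<Otimes>\<^sub>M M)" "\<forall>c z. f c z \<le> ennreal K"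
    "\<forall>c. edge_integral M V E p q (\<lambda>_. f c) \<le> 1"
  define T where "T \<kappa> = edge_integral M V E p q (\<lambda>e. f (\<kappa> e))" for \<kappa> :: "'e \<Rightarrow> bool"
  have cong: "T \<kappa> = T \<kappa>'" if "\<And>e. e \<in> E \<Longrightarrow> \<kappa> e = \<kappa>' e" for \<kappa> \<kappa>'
    unfolding T_def using that by (intro edge_integral_cong) simp
  \<comment> \<open>A colouring matters only on \<open>E\<close>, so it is encoded by its set of
    \<open>True\<close> edges; this leaves finitely many values.\<close>
  define mx where "mx = Max ((\<lambda>X. T (\<lambda>e. e \<in> X)) ` Pow E)"
  have le: "T \<kappa> \<le> mx" for \<kappa>
  proof -
    have "T \<kappa> = T (\<lambda>e. e \<in> {e \<in> E. \<kappa> e})" by (intro cong) auto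
    then show ?thesis unfolding mx_def using E by (intro Max_ge) (auto intro!: image_eqI[of _ _ "{e \<in> E. \<kappa> e}"])
  qed
  have "mx \<in> (\<lambda>X. T (\<lambda>e. e \<in> X)) ` Pow E"
    unfolding mx_def using E by (intro Max_in) auto
  then obtain \<kappa>0 where \<kappa>0: "T \<kappa>0 = mx" by blast
  \<comment> \<open>Needed to cancel \<open>mx\<close> from
    \<open>mx * mx \<le> mx * T (\<kappa> \<circ> \<phi>)\<close> below; this is where the bound
    \<open>K\<close> enters.\<close>
  have "mx < \<infinity>"
    using edge_integral_le[OF M, of E "\<lambda>e. f (\<kappa>0 e)" "ennreal K" V p q] f(2) \<kappa>0
    by (auto simp: T_def power_less_top_ennreal elim!: le_less_trans)
  have step: "T (\<kappa> \<circ> \<phi>) = mx" if "T \<kappa> = mx" "\<phi> \<in> set \<phi>s" for \<kappa> \<phi>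
  proof (cases "mx = 0")
    case True then show ?thesis using le[of "\<kappa> \<circ> \<phi>"] by simp
  next
    case False
    obtain \<phi>' where cs: "Cauchy_Schwarz_pair M V E p q \<phi> \<phi>'" using \<phi>s \<open>\<phi> \<in> set \<phi>s\<close> by blast
    have "(T \<kappa>)\<^sup>2 \<le> T (\<kappa> \<circ> \<phi>) * T (\<kappa> \<circ> \<phi>')"
      using cs f(1) unfolding Cauchy_Schwarz_pair_def T_def comp_def by auto
    also have "\<dots> \<le> T (\<kappa> \<circ> \<phi>) * mx" by (intro mult_left_mono le) auto
    finally have "mx * mx \<le> mx * T (\<kappa> \<circ> \<phi>)" using that by (simp add: power2_eq_square mult.commute)
    then have "mx \<le> T (\<kappa> \<circ> \<phi>)"
      using False \<open>mx < \<infinity>\<close> by (subst (asm) ennreal_mult_le_mult_iff) auto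
    then show ?thesis using le[of "\<kappa> \<circ> \<phi>"] by simp
  qed
  have "T (\<lambda>e. \<kappa> (foldr (\<lambda>\<phi>. \<phi>) \<phi>s' e)) = mx" if "T \<kappa> = mx" "set \<phi>s' \<subseteq> set \<phi>s" for \<kappa> \<phi>s'
    using that
  proof (induction \<phi>s' arbitrary: \<kappa>)
    \<comment> \<open>\<open>foldr\<close> applies the head of the list last to an edge, which means
      that it is the first map to be composed with the colouring.\<close>
    case (Cons \<phi> \<phi>s')
    from Cons.prems have "T (\<kappa> \<circ> \<phi>) = mx" by (intro step) simp_all
    with Cons.prems Cons.IH[of "\<kappa> \<circ> \<phi>"] show ?case by (simp add: comp_def)
  qed simp
  from this[OF \<kappa>0, of \<phi>s] have "mx = T (\<lambda>_. \<kappa>0 e0)"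
    using cong[of "\<lambda>e. \<kappa>0 (foldr (\<lambda>\<phi>. \<phi>) \<phi>s e)" "\<lambda>_. \<kappa>0 e0"] const by simp
  also have "\<dots> \<le> 1" using f(3) by (simp add: T_def)
  finally show "edge_integral M V E p q (\<lambda>e. f (\<kappa> e)) \<le> 1"
    using le[of \<kappa>] unfolding T_def by (rule order_trans[rotated])
qed

section \<open>Subadditivity and definiteness from the Hoelder inequality\<close>

lemma edge_integral_cmult:
  assumes "finite E" "p ` E \<subseteq> V" "q ` E \<subseteq> V" "\<And>e. e \<in> E \<Longrightarrow> u e \<in> borel_measurable (M \<Otimes>\<^sub>M M)"
  shows "edge_integral M V E p q (\<lambda>e z. c e * u e z) = (\<Prod>e\<in>E. c e) * edge_integral M V E p q u"
proof -
  have "(\<lambda>x. u e (x (p e), x (q e))) \<in> borel_measurable (PiM V (\<lambda>_. M))" if "e \<in> E" for e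
    by (rule measurable_compose[OF _ assms(4)[OF that]])
      (use assms that in \<open>intro measurable_Pair measurable_component_singleton; auto\<close>)
  then have "(\<lambda>x. \<Prod>e\<in>E. u e (x (p e), x (q e))) \<in> borel_measurable (PiM V (\<lambda>_. M))"
    by (rule borel_measurable_prod_ennreal)
  then show ?thesis
    unfolding edge_integral_def by (simp add: prod.distrib nn_integral_cmult)
qed

text \<open>Write \<open>F\<close> as \<open>a\<close> times a normalised function, \<open>G\<close>
  as \<open>b\<close> times another, and expand the product over the edges. The colouring with
  \<open>True\<close> on \<open>X\<close> contributes at most a^|X| b^|E - X|, and these bounds sum
  to (a + b)^|E|. Positive upper bounds \<open>a\<close>, \<open>b\<close> in place of the norms
  allow the division even if a norm vanishes.\<close>

lemma edge_integral_add_le: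
  fixes F G :: "'s \<times> 's \<Rightarrow> ennreal" and E :: "'e set"
  assumes M: "prob_space M" and E: "finite E" "p ` E \<subseteq> V" "q ` E \<subseteq> V"
    and H: "edge_Hoelder M V E p q"
    and [measurable]: "F \<in> borel_measurable (M \<Otimes>\<^sub>M M)" "G \<in> borel_measurable (M \<Otimes>\<^sub>M M)"
    and bnd: "\<And>z. F z \<le> ennreal K" "\<And>z. G z \<le> ennreal K"
    and ab: "a > 0" "b > 0"
    and F: "edge_integral M V E p q (\<lambda>_. F) \<le> ennreal (a ^ card E)"
    and G: "edge_integral M V E p q (\<lambda>_. G) \<le> ennreal (b ^ card E)"
  shows "edge_integral M V E p q (\<lambda>_ z. F z + G z) \<le> ennreal ((a + b) ^ card E)"
proof -
  define w where "w c = (if c then a else b)" for c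
  have w: "w c > 0" for c using ab by (simp add: w_def)
  define f where "f c z = ennreal (1 / w c) * (if c then F z else G z)" for c z
  have fm[measurable]: "f c \<in> borel_measurable (M \<Otimes>\<^sub>M M)" for c
    unfolding f_def by (cases c) auto
  have FG: "F z + G z = ennreal a * f True z + ennreal b * f False z" for z
    using ab by (simp add: f_def w_def flip: mult.assoc ennreal_mult')
  have "f c z \<le> ennreal (1 / w c) * ennreal K" for c z
    unfolding f_def using bnd by (intro mult_left_mono) auto
  \<comment> \<open>One bound has to serve both colours. A negative \<open>K\<close> is first raised
    to 0, since enlarging the factor \<open>1 / w c\<close> would otherwise lower the
    product.\<close>
  also have "ennreal (1 / w c) * ennreal K \<le> ennreal (max (1 / a) (1 / b) * max 0 K)" for c
  proof -
    have "1 / w c * K \<le> 1 / w c * max 0 K"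
      using w[of c] by (intro mult_left_mono) auto
    also have "\<dots> \<le> max (1 / a) (1 / b) * max 0 K"
      by (intro mult_right_mono) (auto simp: w_def)
    finally show ?thesis
      using w[of c] by (auto simp: less_imp_le ennreal_leI simp flip: ennreal_mult')
  qed
  finally have bf: "f c z \<le> ennreal (max (1 / a) (1 / b) * max 0 K)" for c z .
  have nf: "edge_integral M V E p q (\<lambda>_. f c) \<le> 1" for c
  proof -
    have "edge_integral M V E p q (\<lambda>_. f c) =
        ennreal (1 / w c) ^ card E * edge_integral M V E p q (\<lambda>_. if c then F else G)"
      using edge_integral_cmult[OF E, of "\<lambda>_. if c then F else G" M "\<lambda>_. ennreal (1 / w c)"]
      unfolding f_def by (cases c) auto
    also have "\<dots> \<le> ennreal (1 / w c) ^ card E * ennreal (w c ^ card E)"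
      using F G by (intro mult_left_mono) (auto simp: w_def)
    also have "\<dots> = 1"
      using w[of c] by (simp add: ennreal_power power_one_over less_imp_le flip: ennreal_mult')
    finally show ?thesis .
  qed
  have le1: "edge_integral M V E p q (\<lambda>e. f (\<kappa> e)) \<le> 1" for \<kappa>
    using H fm bf nf unfolding edge_Hoelder_def by blast
  have meas: "(\<lambda>x. f c (x (p e), x (q e))) \<in> borel_measurable (PiM V (\<lambda>_. M))" if "e \<in> E" for c e
    by (rule measurable_compose[OF _ fm])
      (use E that in \<open>intro measurable_Pair measurable_component_singleton; auto\<close>)
  let ?P = "\<lambda>X x. (\<Prod>e\<in>E. f (e \<in> X) (x (p e), x (q e)))"
  have meas': "?P X \<in> borel_measurable (PiM V (\<lambda>_. M))" for X
    by (intro borel_measurable_prod_ennreal meas)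
  have split: "(\<Prod>e\<in>E. g (e \<in> X) e) = (\<Prod>e\<in>X. g True e) * (\<Prod>e\<in>E - X. g False e)"
    if "X \<subseteq> E" for X and g :: "bool \<Rightarrow> 'e \<Rightarrow> ennreal"
    using that E(1) by (subst prod.subset_diff[of X E]) (auto simp: mult.commute intro!: arg_cong2[where f="(*)"] prod.cong)
  have "edge_integral M V E p q (\<lambda>_ z. F z + G z) =
     (\<integral>\<^sup>+x. (\<Sum>X\<in>Pow E. (\<Prod>e\<in>E. ennreal (w (e \<in> X))) * ?P X x) \<partial>PiM V (\<lambda>_. M))"
    unfolding edge_integral_def
  proof (rule nn_integral_cong)
    fix x
    have "(\<Prod>e\<in>E. F (x (p e), x (q e)) + G (x (p e), x (q e))) =
      (\<Sum>X\<in>Pow E. (\<Prod>e\<in>X. ennreal a * f True (x (p e), x (q e))) * (\<Prod>e\<in>E-X. ennreal b * f False (x (p e), x (q e))))"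
      unfolding FG by (rule prod_add[OF E(1)])
    also have "\<dots> = (\<Sum>X\<in>Pow E. (\<Prod>e\<in>E. ennreal (w (e \<in> X)) * f (e \<in> X) (x (p e), x (q e))))"
      by (rule sum.cong[OF refl], subst split[where g="\<lambda>c e. ennreal (w c) * f c (x (p e), x (q e))"])
        (auto simp: w_def)
    finally show "(\<Prod>e\<in>E. F (x (p e), x (q e)) + G (x (p e), x (q e))) =
      (\<Sum>X\<in>Pow E. (\<Prod>e\<in>E. ennreal (w (e \<in> X))) * ?P X x)"
      by (simp add: prod.distrib)
  qed
  also have "\<dots> = (\<Sum>X\<in>Pow E. (\<Prod>e\<in>E. ennreal (w (e \<in> X))) * edge_integral M V E p q (\<lambda>e. f (e \<in> X)))"
    unfolding edge_integral_def using meas'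
    by (subst nn_integral_sum) (auto simp: nn_integral_cmult)
  also have "\<dots> \<le> (\<Sum>X\<in>Pow E. (\<Prod>e\<in>E. ennreal (w (e \<in> X))) * 1)"
    by (intro sum_mono mult_left_mono le1) auto
  also have "\<dots> = (\<Sum>X\<in>Pow E. (\<Prod>e\<in>X. ennreal a) * (\<Prod>e\<in>E - X. ennreal b))"
    by (rule sum.cong[OF refl], subst split[where g="\<lambda>c e. ennreal (w c)"]) (auto simp: w_def)
  also have "\<dots> = (\<Prod>e\<in>E. ennreal a + ennreal b)"
    by (rule prod_add[OF E(1), symmetric])
  also have "\<dots> = ennreal ((a + b) ^ card E)"
    using ab by (simp add: ennreal_power flip: ennreal_plus)
  finally show ?thesis .
qed

text \<open>Amplification: the integral with \<open>F\<close> on all edges stays 0 when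
  \<open>F\<close> is scaled by any \<open>n\<close>, whereas \<open>F\<close> on one edge scales
  linearly, so the Hoelder bound 1 for all \<open>n\<close> forces the integral of \<open>F\<close>
  to vanish. The ends of \<open>e0\<close> must differ for the edge to see the full product
  measure.\<close>

lemma edge_integral_eq_0D:
  assumes M: "prob_space M" and E: "finite E" "p ` E \<subseteq> V" "q ` E \<subseteq> V" "e0 \<in> E" "p e0 \<noteq> q e0"
    and H: "edge_Hoelder M V E p q"
    and Fm[measurable]: "F \<in> borel_measurable (M \<Otimes>\<^sub>M M)"
    and bnd: "\<And>z. F z \<le> ennreal K"
    and F: "edge_integral M V E p q (\<lambda>_. F) = 0"
  shows "(\<integral>\<^sup>+z. F z \<partial>(M \<Otimes>\<^sub>M M)) = 0"
proof -
  interpret P: prob_space "PiM V (\<lambda>_. M)"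
    using M by (intro prob_space_PiM)
  let ?I = "\<integral>\<^sup>+z. F z \<partial>(M \<Otimes>\<^sub>M M)"
  \<comment> \<open>Colour one edge with \<open>n F\<close> and all others with 1.\<close>
  have "of_nat n * ?I \<le> 1" for n
  proof -
    define f where "f c z = (if c then ennreal (real n) * F z else 1)" for c z
    have fm: "f c \<in> borel_measurable (M \<Otimes>\<^sub>M M)" for c
      unfolding f_def by (cases c) auto
    have "f c z \<le> ennreal (max 1 (real n * K))" for c z
    proof (cases c)
      case True
      have "ennreal (real n) * F z \<le> ennreal (real n) * ennreal K"
        by (intro mult_left_mono bnd) simp
      also have "\<dots> = ennreal (real n * K)" by (simp add: ennreal_mult')
      also have "\<dots> \<le> ennreal (max 1 (real n * K))" by (intro ennreal_leI) simp
      finally show ?thesis using True by (simp add: f_def)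
    next
      case False
      have "ennreal 1 \<le> ennreal (max 1 (real n * K))" by (intro ennreal_leI) simp
      then show ?thesis using False by (simp add: f_def)
    qed
    moreover have "edge_integral M V E p q (\<lambda>_. f c) \<le> 1" for c
    proof (cases c)
      case True
      then have "edge_integral M V E p q (\<lambda>_. f c) = (\<Prod>e\<in>E. ennreal (real n)) * edge_integral M V E p q (\<lambda>_. F)"
        unfolding f_def using edge_integral_cmult[OF E(1-3), of "\<lambda>_. F" M "\<lambda>_. ennreal (real n)"] by simp
      then show ?thesis using F by simp
    next
      case False
      then show ?thesis by (simp add: edge_integral_def f_def P.emeasure_space_1)
    qed
    ultimately have "edge_integral M V E p q (\<lambda>e. f (e = e0)) \<le> 1"
      using H[unfolded edge_Hoelder_def, rule_format, of f "max 1 (real n * K)" "\<lambda>e. e = e0"] fm by simp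
    moreover have "edge_integral M V E p q (\<lambda>e. f (e = e0)) = of_nat n * ?I"
    proof -
      have "(\<Prod>e\<in>E. f (e = e0) (x (p e), x (q e))) = of_nat n * F (x (p e0), x (q e0))" for x
        using E by (simp add: f_def ennreal_of_nat_eq_real_of_nat)
      then have "edge_integral M V E p q (\<lambda>e. f (e = e0)) =
        (\<integral>\<^sup>+x. of_nat n * F (x (p e0), x (q e0)) \<partial>PiM V (\<lambda>_. M))"
        by (simp add: edge_integral_def)
      also have "\<dots> = (\<integral>\<^sup>+z. of_nat n * F z \<partial>distr (PiM V (\<lambda>_. M)) (M \<Otimes>\<^sub>M M) (\<lambda>x. (x (p e0), x (q e0))))"
        using E by (subst nn_integral_distr) (auto intro!: measurable_Pair measurable_component_singleton)
      also have "\<dots> = of_nat n * ?I"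
        using E M by (subst distr_PiM_pair) (auto simp: nn_integral_cmult)
      finally show ?thesis .
    qed
    ultimately show ?thesis by simp
  qed
  note le = this
  show ?thesis
  proof (cases ?I)
    case (real r)
    have "real n * r \<le> 1" for n
      using le[of n] real by (simp add: ennreal_of_nat_eq_real_of_nat flip: ennreal_mult')
    note * = this
    have "r \<le> 0"
    proof (rule ccontr)
      assume "\<not> r \<le> 0"
      then obtain n where "1 < real n * r" using reals_Archimedean3[of r] by auto
      with *[of n] show False by simp
    qed
    then show ?thesis using real by simp
  next
    case top
    then show ?thesis using le[of 1] by (simp add: top_unique)
  qed
qed

section \<open>Norms on the unit square\<close>

abbreviation unit_lborel :: "real measure" where
  "unit_lborel \<equiv> restrict_space lborel {0..1}"

abbreviation graph_integral :: "('a, 'b) bigraph \<Rightarrow> (real \<times> real \<Rightarrow> ennreal) \<Rightarrow> ennreal" where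
  "graph_integral H F \<equiv> edge_integral unit_lborel (vertex_set H) (edge_set H)
     (\<lambda>e. Inl (fst e)) (\<lambda>e. Inr (snd e)) (\<lambda>_. F)"

lemma prob_space_unit_lborel: "prob_space unit_lborel"
  by (intro prob_spaceI) (simp add: emeasure_restrict_space)

lemma borel_measurable_unit_pair:
  assumes "h \<in> borel_measurable borel"
  shows "h \<in> borel_measurable (unit_lborel \<Otimes>\<^sub>M unit_lborel)"
proof -
  have "(\<lambda>z. z) \<in> unit_lborel \<Otimes>\<^sub>M unit_lborel \<rightarrow>\<^sub>M (borel \<Otimes>\<^sub>M borel)"
    by (rule measurable_pair) (auto simp: comp_def intro!: measurable_restrict_space3 measurable_compose[OF measurable_fst] measurable_compose[OF measurable_snd] measurable_restrict_space1)
  then show ?thesis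
    using assms by (auto simp: borel_prod dest: measurable_compose)
qed

lemma nn_integral_unit_pair:
  fixes h :: "real \<times> real \<Rightarrow> ennreal"
  assumes [measurable]: "h \<in> borel_measurable borel"
  shows "(\<integral>\<^sup>+z. h z \<partial>(unit_lborel \<Otimes>\<^sub>M unit_lborel)) = (\<integral>\<^sup>+z. h z * indicator ({0..1} \<times> {0..1}) z \<partial>lborel)"
proof -
  interpret M: prob_space unit_lborel by (rule prob_space_unit_lborel)
  have [measurable]: "h \<in> borel_measurable (borel \<Otimes>\<^sub>M borel)"
    by (simp add: borel_prod)
  have "(\<integral>\<^sup>+z. h z \<partial>(unit_lborel \<Otimes>\<^sub>M unit_lborel)) = (\<integral>\<^sup>+x. \<integral>\<^sup>+y. h (x, y) \<partial>unit_lborel \<partial>unit_lborel)"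
    by (rule M.nn_integral_fst[symmetric]) (rule borel_measurable_unit_pair, fact)
  also have "\<dots> = (\<integral>\<^sup>+x. (\<integral>\<^sup>+y. h (x, y) * indicator {0..1} y \<partial>lborel) * indicator {0..1} x \<partial>lborel)"
    by (simp add: nn_integral_restrict_space)
  also have "\<dots> = (\<integral>\<^sup>+x. \<integral>\<^sup>+y. h (x, y) * indicator ({0..1} \<times> {0..1}) (x, y) \<partial>lborel \<partial>lborel)"
    by (intro nn_integral_cong) (auto simp: indicator_def)
  also have "\<dots> = (\<integral>\<^sup>+z. h z * indicator ({0..1} \<times> {0..1}) z \<partial>(lborel \<Otimes>\<^sub>M lborel))"
    by (rule lborel.nn_integral_fst) measurable
  finally show ?thesis by (simp add: lborel_prod)
qed

text \<open>Cover the exceptional set by a Borel null set; its indicator integrates to 0 over the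
  square by \<open>nn_integral_unit_pair\<close>.\<close>

lemma AE_lborel_imp_AE_unit_pair:
  assumes "AE z in (lborel :: (real \<times> real) measure). z \<in> {0..1} \<times> {0..1} \<longrightarrow> P z"
  shows "AE z in unit_lborel \<Otimes>\<^sub>M unit_lborel. P z"
proof -
  obtain N :: "(real \<times> real) set" where N: "{z. \<not> (z \<in> {0..1} \<times> {0..1} \<longrightarrow> P z)} \<subseteq> N" "N \<in> null_sets lborel"
    using assms by (force simp: eventually_ae_filter)
  then have [measurable]: "N \<in> sets borel" by auto
  have "(\<integral>\<^sup>+z. indicator N z \<partial>(unit_lborel \<Otimes>\<^sub>M unit_lborel)) \<le> (\<integral>\<^sup>+z. indicator N z \<partial>lborel)"
    by (subst nn_integral_unit_pair) (auto intro!: nn_integral_mono simp: indicator_def simp del: nn_integral_indicator)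
  also have "\<dots> = 0" using N(2) by (simp add: null_sets_def)
  finally have "AE z in unit_lborel \<Otimes>\<^sub>M unit_lborel. indicator N z = (0::ennreal)"
    by (subst (asm) le_zero_eq, subst (asm) nn_integral_0_iff_AE)
       (auto intro!: borel_measurable_unit_pair)
  then show ?thesis
    using AE_space
  proof eventually_elim
    case (elim z)
    then have "z \<in> {0..1} \<times> {0..1}" by (cases z) (auto simp: space_pair_measure space_restrict_space)
    then show ?case using elim N(1) by (auto simp: indicator_def split: if_splits)
  qed
qed

text \<open>The preimages under \<open>f\<close> and \<open>g\<close> differ by a subset of a null
  set. This is what makes the integrand of \<open>r_norm\<close> measurable when \<open>f\<close> is
  only Lebesgue measurable.\<close>

lemma borel_measurable_completion_AE:
  fixes f g :: "'a \<Rightarrow> real"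
  assumes g: "g \<in> borel_measurable (completion M)" and ae: "AE x in completion M. f x = g x"
  shows "f \<in> borel_measurable (completion M)"
proof (rule measurableI)
  fix A :: "real set" assume "A \<in> sets borel"
  then have "g -` A \<inter> space (completion M) \<in> sets (completion M)"
    using g by (rule measurable_sets[rotated])
  then show "f -` A \<inter> space (completion M) \<in> sets (completion M)"
    by (rule completion.in_sets_AE[rotated]) (use ae AE_space in \<open>auto elim!: eventually_elim2\<close>)
qed simp

text \<open>The exceptional set of one edge is null by the two-point marginal, and there are
  finitely many edges, so the integrand may be replaced by its Borel version on the whole cube. The
  completed measure then drops out.\<close>

lemma r_norm_eq_graph_integral:
  fixes F :: "real \<times> real \<Rightarrow> real"
  assumes H: "finite_bigraph H"
    and F: "F \<in> borel_measurable borel" "\<And>z. 0 \<le> F z"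
    and ae: "AE z in lborel. z \<in> {0..1} \<times> {0..1} \<longrightarrow> \<bar>f z\<bar> = F z"
  shows "r_norm H f = enn2real (graph_integral H (\<lambda>z. ennreal (F z))) powr (1 / real (card (edge_set H)))"
proof -
  let ?P = "PiM (vertex_set H) (\<lambda>_. unit_lborel)"
  have V: "Inl i \<in> vertex_set H" "Inr j \<in> vertex_set H" if "(i, j) \<in> edge_set H" for i j
    using that H by (auto simp: finite_bigraph_def vertex_set_def)
  have fin: "finite (edge_set H)"
    using H unfolding finite_bigraph_def by (meson finite_SigmaI finite_subset)
  have comp: "(\<lambda>x. (x (Inl i), x (Inr j))) \<in> ?P \<rightarrow>\<^sub>M unit_lborel \<Otimes>\<^sub>M unit_lborel" if "(i, j) \<in> edge_set H" for i j
    using V[OF that] by (intro measurable_Pair measurable_component_singleton)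
  have "AE x in ?P. \<forall>(i, j)\<in>edge_set H. \<bar>f (x (Inl i), x (Inr j))\<bar> = F (x (Inl i), x (Inr j))"
  proof -
    have "AE x in ?P. \<bar>f (x (Inl i), x (Inr j))\<bar> = F (x (Inl i), x (Inr j))" if e: "(i, j) \<in> edge_set H" for i j
      by (rule AE_distrD[OF comp[OF e]], subst distr_PiM_pair[OF prob_space_unit_lborel V[OF e]])
        (auto intro: AE_lborel_imp_AE_unit_pair[OF ae])
    then show ?thesis
      using fin by (auto simp: AE_finite_all split_beta)
  qed
  then have eq: "AE x in ?P. (\<Prod>(i, j)\<in>edge_set H. \<bar>f (x (Inl i), x (Inr j))\<bar>) =
       (\<Prod>e\<in>edge_set H. F (x (Inl (fst e)), x (Inr (snd e))))"
    by eventually_elim (auto intro!: prod.cong)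
  have meas: "(\<lambda>x. \<Prod>e\<in>edge_set H. F (x (Inl (fst e)), x (Inr (snd e)))) \<in> borel_measurable ?P"
  proof (rule borel_measurable_prod)
    fix e assume "e \<in> edge_set H"
    then show "(\<lambda>x. F (x (Inl (fst e)), x (Inr (snd e)))) \<in> borel_measurable ?P"
      using comp[of "fst e" "snd e"] borel_measurable_unit_pair[OF F(1)]
      by (auto intro: measurable_compose)
  qed
  have "(\<integral>x. (\<Prod>(i, j)\<in>edge_set H. \<bar>f (x (Inl i), x (Inr j))\<bar>) \<partial>cube_measure (vertex_set H)) =
     (\<integral>x. (\<Prod>e\<in>edge_set H. F (x (Inl (fst e)), x (Inr (snd e)))) \<partial>cube_measure (vertex_set H))"
    unfolding cube_measure_def using eq meas
    by (intro integral_cong_AE borel_measurable_completion_AE[OF measurable_completion[OF meas]])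
      (auto intro: AE_completion measurable_completion)
  also have "\<dots> = (\<integral>x. (\<Prod>e\<in>edge_set H. F (x (Inl (fst e)), x (Inr (snd e)))) \<partial>?P)"
    unfolding cube_measure_def by (rule integral_completion[OF meas])
  also have "\<dots> = enn2real (graph_integral H (\<lambda>z. ennreal (F z)))"
    unfolding edge_integral_def using meas F(2)
    by (subst integral_eq_nn_integral) (auto simp: prod_nonneg prod_ennreal)
  finally show ?thesis unfolding r_norm_def by simp
qed

text \<open>A Borel function agrees almost everywhere with the extension of \<open>f\<close> by 0.
  Truncating its absolute value makes the bound hold everywhere, as \<open>edge_Hoelder\<close>
  demands.\<close>

lemma bounded_measurable_representative:
  assumes "f \<in> bounded_measurable"
  obtains F K where "F \<in> borel_measurable borel" "\<And>z. 0 \<le> F z" "\<And>z. F z \<le> K"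
    "AE z in lborel. z \<in> {0..1} \<times> {0..1} \<longrightarrow> \<bar>f z\<bar> = F z"
proof -
  let ?S = "{0..1} \<times> {0..1} :: (real \<times> real) set"
  have S: "?S \<in> sets lborel" by (simp add: borel_closed closed_Times)
  have "(\<lambda>z. if z \<in> ?S then f z else 0) \<in> borel_measurable lebesgue"
    using assms S unfolding bounded_measurable_def
    by (subst measurable_restrict_space_iff[symmetric]) auto
  then obtain g where g: "g \<in> borel_measurable lborel" "AE z in lborel. (if z \<in> ?S then f z else 0) = g z"
    using completion_ex_borel_measurable_real by blast
  obtain K where K: "\<And>z. z \<in> ?S \<Longrightarrow> \<bar>f z\<bar> \<le> K"
    using assms unfolding bounded_measurable_def bounded_iff by auto
  show thesis
  proof (rule that[of "\<lambda>z. min (max 0 K) \<bar>g z\<bar>" "max 0 K"])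
    show "AE z in lborel. z \<in> ?S \<longrightarrow> \<bar>f z\<bar> = min (max 0 K) \<bar>g z\<bar>"
      using g(2)
    proof eventually_elim
      case (elim z)
      show ?case using elim K[of z] by (auto simp: min_def max_def)
    qed
  qed (use g(1) in auto)
qed

lemma AE_lebesgue_on_square_iff:
  "(AE z in lebesgue_on ({0..1} \<times> {0..1}). P z) \<longleftrightarrow>
   (AE z in (lborel :: (real \<times> real) measure). z \<in> {0..1} \<times> {0..1} \<longrightarrow> P z)"
proof -
  have "{0..1} \<times> {0..1} \<in> sets (lborel :: (real \<times> real) measure)"
    by (simp add: borel_closed closed_Times)
  then show ?thesis
    by (subst AE_restrict_space_iff) (auto simp: AE_completion_iff)
qed

lemma r_norm_mult:
  assumes "finite (edge_set H)" "edge_set H \<noteq> {}"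
  shows "r_norm H (\<lambda>z. c * f z) = \<bar>c\<bar> * r_norm H f"
proof -
  let ?m = "card (edge_set H)"
  have m: "?m > 0" using assms by (simp add: card_gt_0_iff)
  have "(\<bar>c\<bar> ^ ?m) powr (1 / real ?m) = \<bar>c\<bar>"
    using m by (cases "c = 0") (auto simp: powr_powr simp flip: powr_realpow)
  moreover have "0 \<le> (\<integral>x. (\<Prod>(i, j)\<in>edge_set H. \<bar>f (x (Inl i), x (Inr j))\<bar>) \<partial>cube_measure (vertex_set H))"
    by (intro integral_nonneg_AE AE_I2 prod_nonneg) auto
  ultimately show ?thesis
    unfolding r_norm_def by (simp add: abs_mult prod.distrib split_beta powr_mult)
qed

lemma graph_integral_finite:
  assumes "\<And>z. F z \<le> K"
  shows "graph_integral H (\<lambda>z. ennreal (F z)) < \<infinity>"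
proof -
  have "graph_integral H (\<lambda>z. ennreal (F z)) \<le> ennreal K ^ card (edge_set H)"
    by (intro edge_integral_le prob_space_unit_lborel ennreal_leI assms)
  also have "\<dots> < \<infinity>" by (simp add: power_less_top_ennreal)
  finally show ?thesis .
qed

lemma weakly_norming_if_edge_Hoelder:
  assumes H: "finite_bigraph H" "edge_set H \<noteq> {}"
    and Hoelder: "edge_Hoelder unit_lborel (vertex_set H) (edge_set H)
      (\<lambda>e. Inl (fst e)) (\<lambda>e. Inr (snd e))"
  shows "weakly_norming H"
  unfolding weakly_norming_def norm_on_bounded_measurable_def
proof (intro conjI ballI allI)
  let ?S = "{0..1} \<times> {0..1} :: (real \<times> real) set"
  let ?m = "card (edge_set H)"
  have fin: "finite (edge_set H)"
    using H unfolding finite_bigraph_def by (meson finite_SigmaI finite_subset)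
  have m: "?m > 0" using fin H by (simp add: card_gt_0_iff)
  have V: "(\<lambda>e. Inl (fst e)) ` edge_set H \<subseteq> vertex_set H" "(\<lambda>e. Inr (snd e)) ` edge_set H \<subseteq> vertex_set H"
    using H by (auto simp: finite_bigraph_def vertex_set_def)
  show "finite_bigraph H" by fact
  show "0 \<le> r_norm H f" for f by (simp add: r_norm_def)
  show "r_norm H (\<lambda>z. c * f z) = \<bar>c\<bar> * r_norm H f" for f c
    using fin H by (intro r_norm_mult)
  show "r_norm H f = 0 \<longleftrightarrow> (AE z in lebesgue_on ?S. f z = 0)" if f: "f \<in> bounded_measurable" for f
  proof
    assume 0: "r_norm H f = 0"
    obtain F K where F: "F \<in> borel_measurable borel" "\<And>z. 0 \<le> F z" "\<And>z. F z \<le> K"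
      "AE z in lborel. z \<in> ?S \<longrightarrow> \<bar>f z\<bar> = F z"
      using bounded_measurable_representative[OF f] by blast
    have [measurable]: "(\<lambda>z. ennreal (F z)) \<in> borel_measurable borel" using F(1) by simp
    have "graph_integral H (\<lambda>z. ennreal (F z)) = 0"
      using 0 r_norm_eq_graph_integral[OF H(1) F(1,2,4)] graph_integral_finite[of F K, OF F(3), of H]
      by (auto simp: enn2real_eq_0_iff)
    moreover obtain e0 where "e0 \<in> edge_set H" using H(2) by blast
    ultimately have "(\<integral>\<^sup>+z. ennreal (F z) \<partial>(unit_lborel \<Otimes>\<^sub>M unit_lborel)) = 0"
      using H F(3) fin V by (intro edge_integral_eq_0D[OF prob_space_unit_lborel _ _ _ _ _ Hoelder, where ?e0.0 = e0 and K = K])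
         (auto intro!: borel_measurable_unit_pair ennreal_leI)
    then have "AE z in lborel. ennreal (F z) * indicator ?S z = 0"
      by (subst (asm) nn_integral_unit_pair, simp, subst (asm) nn_integral_0_iff_AE)
        (auto simp: borel_closed closed_Times)
    with F(4) have "AE z in lborel. z \<in> ?S \<longrightarrow> f z = 0"
    proof eventually_elim
      case (elim z)
      then show ?case using F(2)[of z] by (auto simp: indicator_def split: if_splits)
    qed
    then show "AE z in lebesgue_on ?S. f z = 0" by (simp only: AE_lebesgue_on_square_iff)
  next
    assume "AE z in lebesgue_on ?S. f z = 0"
    then have "AE z in lborel. z \<in> ?S \<longrightarrow> \<bar>f z\<bar> = 0" by (simp only: AE_lebesgue_on_square_iff abs_eq_0)
    from r_norm_eq_graph_integral[OF H(1) _ _ this] show "r_norm H f = 0"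
      using m by (simp add: edge_integral_def zero_power)
  qed
  show "r_norm H (\<lambda>z. f z + g z) \<le> r_norm H f + r_norm H g"
    if fg: "f \<in> bounded_measurable" "g \<in> bounded_measurable" for f g
  proof -
    obtain F K where F: "F \<in> borel_measurable borel" "\<And>z. 0 \<le> F z" "\<And>z. F z \<le> K"
      "AE z in lborel. z \<in> ?S \<longrightarrow> \<bar>f z\<bar> = F z"
      using bounded_measurable_representative[OF fg(1)] by blast
    obtain G L where G: "G \<in> borel_measurable borel" "\<And>z. 0 \<le> G z" "\<And>z. G z \<le> L"
      "AE z in lborel. z \<in> ?S \<longrightarrow> \<bar>g z\<bar> = G z"
      using bounded_measurable_representative[OF fg(2)] by blast
    have "(\<lambda>z. f z + g z) \<in> bounded_measurable"
      using fg by (auto simp: bounded_measurable_def intro: bounded_plus_comp)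
    then obtain D N where D: "D \<in> borel_measurable borel" "\<And>z. 0 \<le> D z" "\<And>z. D z \<le> N"
      "AE z in lborel. z \<in> ?S \<longrightarrow> \<bar>f z + g z\<bar> = D z"
      using bounded_measurable_representative by blast
    \<comment> \<open>\<open>D\<close> is bounded by \<open>F + G\<close> only almost everywhere;
      the minimum is still a representative of |f + g| and obeys the bound at every point.\<close>
    define E where "E z = min (D z) (F z + G z)" for z
    have E: "E \<in> borel_measurable borel" "\<And>z. 0 \<le> E z" "\<And>z. E z \<le> N" "\<And>z. E z \<le> F z + G z"
      unfolding E_def using D F G by (auto intro: order_trans[OF min.cobounded1])
    have "AE z in lborel. z \<in> ?S \<longrightarrow> \<bar>f z + g z\<bar> = E z"
      using D(4) F(4) G(4)
    proof eventually_elim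
      case (elim z)
      then show ?case using abs_triangle_ineq[of "f z" "g z"] by (auto simp: E_def)
    qed
    note rE = r_norm_eq_graph_integral[OF H(1) E(1,2) this]
    note rF = r_norm_eq_graph_integral[OF H(1) F(1,2,4)]
    note rG = r_norm_eq_graph_integral[OF H(1) G(1,2,4)]
    have le_pow: "graph_integral H (\<lambda>z. ennreal (F z)) \<le> ennreal (a ^ ?m)"
      if "\<And>z. F z \<le> K" "enn2real (graph_integral H (\<lambda>z. ennreal (F z))) powr (1 / real ?m) \<le> a" "a > 0" for F K a
    proof -
      let ?t = "graph_integral H (\<lambda>z. ennreal (F z))"
      have "enn2real ?t = (enn2real ?t powr (1 / real ?m)) ^ ?m"
        using m by (cases "enn2real ?t = 0") (auto simp: powr_powr simp flip: powr_realpow)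
      also have "\<dots> \<le> a ^ ?m"
        using that by (intro power_mono) auto
      finally have "ennreal (enn2real ?t) \<le> ennreal (a ^ ?m)" by (rule ennreal_leI)
      then show ?thesis using graph_integral_finite[of F K H] that by simp
    qed
    \<comment> \<open>The summand \<open>\<epsilon>\<close> makes both bounds positive, as
      \<open>edge_integral_add_le\<close> requires even for functions of norm 0.\<close>
    have "r_norm H (\<lambda>z. f z + g z) \<le> (r_norm H f + \<epsilon>) + (r_norm H g + \<epsilon>)" if "\<epsilon> > 0" for \<epsilon>
    proof -
      let ?a = "r_norm H f + \<epsilon>" and ?b = "r_norm H g + \<epsilon>"
      have ab: "?a > 0" "?b > 0"
        using that by (auto simp: r_norm_def intro: add_nonneg_pos)
      have "graph_integral H (\<lambda>z. ennreal (E z)) \<le> graph_integral H (\<lambda>z. ennreal (F z) + ennreal (G z))"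
        unfolding edge_integral_def
      proof (intro nn_integral_mono)
        fix x
        have "(\<Prod>e\<in>edge_set H. ennreal (E (x (Inl (fst e)), x (Inr (snd e))))) =
           ennreal (\<Prod>e\<in>edge_set H. E (x (Inl (fst e)), x (Inr (snd e))))"
          by (rule prod_ennreal) (rule E)
        also have "\<dots> \<le> ennreal (\<Prod>e\<in>edge_set H. F (x (Inl (fst e)), x (Inr (snd e))) + G (x (Inl (fst e)), x (Inr (snd e))))"
          by (intro ennreal_leI prod_mono conjI E)
        also have "\<dots> = (\<Prod>e\<in>edge_set H. ennreal (F (x (Inl (fst e)), x (Inr (snd e)))) + ennreal (G (x (Inl (fst e)), x (Inr (snd e)))))"
          by (subst prod_ennreal[symmetric]) (auto simp: F G ennreal_plus)
        finally show "(\<Prod>e\<in>edge_set H. ennreal (E (x (Inl (fst e)), x (Inr (snd e))))) \<le>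
          (\<Prod>e\<in>edge_set H. ennreal (F (x (Inl (fst e)), x (Inr (snd e)))) + ennreal (G (x (Inl (fst e)), x (Inr (snd e)))))" .
      qed
      also have "\<dots> \<le> ennreal ((?a + ?b) ^ ?m)"
      proof (rule edge_integral_add_le[OF prob_space_unit_lborel fin V Hoelder, where K = "max K L"])
        show "ennreal (F z) \<le> ennreal (max K L)" "ennreal (G z) \<le> ennreal (max K L)" for z
          using F(3)[of z] G(3)[of z] by (auto intro!: ennreal_leI simp: max_def intro: order_trans)
        show "graph_integral H (\<lambda>z. ennreal (F z)) \<le> ennreal (?a ^ ?m)"
          using ab that rF by (intro le_pow[of F K] F) auto
        show "graph_integral H (\<lambda>z. ennreal (G z)) \<le> ennreal (?b ^ ?m)"
          using ab that rG by (intro le_pow[of G L] G) auto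
      qed (use ab F G in \<open>auto intro!: borel_measurable_unit_pair\<close>)
      finally have "enn2real (graph_integral H (\<lambda>z. ennreal (E z))) \<le> (?a + ?b) ^ ?m"
        using ab by (intro enn2real_leI) auto
      then have "r_norm H (\<lambda>z. f z + g z) \<le> ((?a + ?b) ^ ?m) powr (1 / real ?m)"
        unfolding rE by (intro powr_mono2) auto
      also have "\<dots> = ?a + ?b"
        using ab m by (simp add: powr_powr flip: powr_realpow)
      finally show ?thesis .
    qed
    from this[of "\<epsilon> / 2" for \<epsilon>]
    have "r_norm H (\<lambda>z. f z + g z) \<le> (r_norm H f + r_norm H g) + \<epsilon>" if "\<epsilon> > 0" for \<epsilon>
      using that by (simp add: add.assoc add.left_commute)
    then show ?thesis by (rule field_le_epsilon)
  qed
qed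

section \<open>Folding coset graphs\<close>

text \<open>The form of \<open>reflection_graph\<close> over an arbitrary group, so that folding can
  be treated without linear algebra.\<close>

definition coset_graph :: "('a, 'b) monoid_scheme \<Rightarrow> 'a set \<Rightarrow> 'a set \<Rightarrow> ('a set, 'a set) bigraph" where
  "coset_graph G H1 H2 = \<lparr>left_part = lcosets\<^bsub>G\<^esub> H1, right_part = lcosets\<^bsub>G\<^esub> H2,
     edge_set = (\<lambda>w. (w <#\<^bsub>G\<^esub> H1, w <#\<^bsub>G\<^esub> H2)) ` carrier G\<rparr>"

text \<open>A wall is an involution together with the set of elements on its positive side; a coset of
  \<open>H\<close> that is moved by the involution must lie entirely on one side.\<close>

definition wall :: "('a, 'b) monoid_scheme \<Rightarrow> 'a set \<Rightarrow> 'a \<times> ('a \<Rightarrow> bool) \<Rightarrow> bool" where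
  "wall G H = (\<lambda>(s, pos). s \<in> carrier G \<and> s \<otimes>\<^bsub>G\<^esub> s = \<one>\<^bsub>G\<^esub> \<and>
     (\<forall>w\<in>carrier G. pos (s \<otimes>\<^bsub>G\<^esub> w) \<longleftrightarrow> \<not> pos w) \<and>
     (\<forall>w\<in>carrier G. (s \<otimes>\<^bsub>G\<^esub> w) <#\<^bsub>G\<^esub> H = w <#\<^bsub>G\<^esub> H \<or> (\<forall>h\<in>H. pos (w \<otimes>\<^bsub>G\<^esub> h) \<longleftrightarrow> pos w)))"

definition fold_across :: "('a, 'b) monoid_scheme \<Rightarrow> 'a \<times> ('a \<Rightarrow> bool) \<Rightarrow> 'a \<Rightarrow> 'a" where
  "fold_across G = (\<lambda>(s, pos) w. if pos w then w else s \<otimes>\<^bsub>G\<^esub> w)"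

definition fixed_cosets :: "('a, 'b) monoid_scheme \<Rightarrow> 'a set \<Rightarrow> 'a \<Rightarrow> 'a set set" where
  "fixed_cosets G H s = {X \<in> lcosets\<^bsub>G\<^esub> H. s <#\<^bsub>G\<^esub> X = X}"

text \<open>On a coset moved by \<open>s\<close> the sign is constant if \<open>(s, pos)\<close> is
  a wall, so a single positive element decides the side.\<close>

definition positive_cosets :: "('a, 'b) monoid_scheme \<Rightarrow> 'a set \<Rightarrow> 'a \<Rightarrow> ('a \<Rightarrow> bool) \<Rightarrow> 'a set set" where
  "positive_cosets G H s pos = {X \<in> lcosets\<^bsub>G\<^esub> H. s <#\<^bsub>G\<^esub> X \<noteq> X \<and> (\<exists>w\<in>X. pos w)}"

context group
begin

text \<open>Supplies the vertex partition for \<open>edge_integral_fold\<close>. Constancy of the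
  sign on moved cosets enters in the disjointness of \<open>L\<close> and its mirror image: if
  \<open>X\<close> is the image of \<open>Y\<close> and \<open>v\<close> in \<open>Y\<close> is
  positive, then \<open>s \<otimes> v\<close> is a negative element of \<open>X\<close>.\<close>

lemma wall_cosets:
  assumes H: "subgroup H G" and w: "wall G H (s, pos)"
  defines "F \<equiv> fixed_cosets G H s" and "L \<equiv> positive_cosets G H s pos"
  shows "\<And>X. X \<in> lcosets H \<Longrightarrow> s <#\<^bsub>G\<^esub> (s <#\<^bsub>G\<^esub> X) = X"
    and "\<And>w. w \<in> carrier G \<Longrightarrow> s <#\<^bsub>G\<^esub> (w <#\<^bsub>G\<^esub> H) = (s \<otimes> w) <#\<^bsub>G\<^esub> H"
    and "lcosets H = F \<union> (L \<union> (\<lambda>X. s <#\<^bsub>G\<^esub> X) ` L)"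
    and "F \<inter> L = {}" and "F \<inter> (\<lambda>X. s <#\<^bsub>G\<^esub> X) ` L = {}" and "L \<inter> (\<lambda>X. s <#\<^bsub>G\<^esub> X) ` L = {}"
    and "\<And>w. w \<in> carrier G \<Longrightarrow> pos w \<Longrightarrow> w <#\<^bsub>G\<^esub> H \<in> F \<union> L"
proof -
  have s: "s \<in> carrier G" "s \<otimes> s = \<one>" and pos: "\<And>w. w \<in> carrier G \<Longrightarrow> pos (s \<otimes> w) \<longleftrightarrow> \<not> pos w"
    and const: "\<And>w h. w \<in> carrier G \<Longrightarrow> (s \<otimes> w) <#\<^bsub>G\<^esub> H \<noteq> w <#\<^bsub>G\<^esub> H \<Longrightarrow> h \<in> H \<Longrightarrow> pos (w \<otimes> h) \<longleftrightarrow> pos w"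
    using w by (auto simp: wall_def)
  have Hc: "H \<subseteq> carrier G" using H by (rule subgroup.subset)
  show act: "s <#\<^bsub>G\<^esub> (w <#\<^bsub>G\<^esub> H) = (s \<otimes> w) <#\<^bsub>G\<^esub> H" if "w \<in> carrier G" for w
    using that s Hc by (simp add: lcos_m_assoc)
  show invol: "s <#\<^bsub>G\<^esub> (s <#\<^bsub>G\<^esub> X) = X" if "X \<in> lcosets H" for X
    using that s Hc by (auto simp: LCOSETS_def act m_assoc[symmetric] simp del: m_assoc)
  have self: "w \<in> w <#\<^bsub>G\<^esub> H" if "w \<in> carrier G" for w
    using lcos_self[OF that H] .
  have in_lcosets: "w <#\<^bsub>G\<^esub> H \<in> lcosets H" if "w \<in> carrier G" for w
    using that by (auto simp: LCOSETS_def)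
  have s_in: "s <#\<^bsub>G\<^esub> X \<in> lcosets H" if "X \<in> lcosets H" for X
    using that s by (auto simp: LCOSETS_def act)
  show 4: "F \<inter> L = {}" by (auto simp: F_def L_def fixed_cosets_def positive_cosets_def)
  show 5: "F \<inter> (\<lambda>X. s <#\<^bsub>G\<^esub> X) ` L = {}"
    using invol by (force simp: F_def L_def fixed_cosets_def positive_cosets_def)
  show FL: "w <#\<^bsub>G\<^esub> H \<in> F \<union> L" if "w \<in> carrier G" "pos w" for w
    using that self in_lcosets by (auto simp: F_def L_def fixed_cosets_def positive_cosets_def)
  show "L \<inter> (\<lambda>X. s <#\<^bsub>G\<^esub> X) ` L = {}"
  proof (rule ccontr)
    assume "L \<inter> (\<lambda>X. s <#\<^bsub>G\<^esub> X) ` L \<noteq> {}"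
    then obtain X Y where XY: "X \<in> L" "Y \<in> L" "X = s <#\<^bsub>G\<^esub> Y" by blast
    obtain w v where w: "w \<in> X" "pos w" and v: "v \<in> Y" "pos v" "s <#\<^bsub>G\<^esub> X \<noteq> X"
      using XY(1,2) by (auto simp: L_def positive_cosets_def)
    have X: "X \<in> lcosets H" "Y \<in> lcosets H" using XY by (auto simp: L_def positive_cosets_def)
    have wc: "w \<in> carrier G" "v \<in> carrier G"
      using w v X lcosets_part_G[OF H] by blast+
    have Xw: "X = w <#\<^bsub>G\<^esub> H"
      using X(1) w(1) self[OF wc(1)] in_lcosets[OF wc(1)] lcos_disjoint[OF H] by blast
    have "s \<otimes> v \<in> X" using v(1) XY(3) by (auto simp: l_coset_def)
    then obtain h where "h \<in> H" "s \<otimes> v = w \<otimes> h" using Xw by (auto simp: l_coset_def)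
    then have "pos (s \<otimes> v)" using const[OF wc(1)] v(3) w(2) Xw act[OF wc(1)] by metis
    then show False using pos wc v(2) by blast
  qed
  show "lcosets H = F \<union> (L \<union> (\<lambda>X. s <#\<^bsub>G\<^esub> X) ` L)"
  proof
    show "lcosets H \<subseteq> F \<union> (L \<union> (\<lambda>X. s <#\<^bsub>G\<^esub> X) ` L)"
    proof
      fix X assume X: "X \<in> lcosets H"
      then obtain w where w: "w \<in> carrier G" "X = w <#\<^bsub>G\<^esub> H" by (auto simp: LCOSETS_def)
      show "X \<in> F \<union> (L \<union> (\<lambda>X. s <#\<^bsub>G\<^esub> X) ` L)"
      proof (cases "pos w")
        case False
        then have "pos (s \<otimes> w)" using pos w by blast
        then have "s <#\<^bsub>G\<^esub> X \<in> F \<union> L" using FL[of "s \<otimes> w"] w s act by simp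
        moreover have "X = s <#\<^bsub>G\<^esub> (s <#\<^bsub>G\<^esub> X)" using invol[OF X] by simp
        ultimately show ?thesis
          by (auto simp: F_def fixed_cosets_def)
      qed (use FL w in auto)
    qed
    show "F \<union> (L \<union> (\<lambda>X. s <#\<^bsub>G\<^esub> X) ` L) \<subseteq> lcosets H"
      using s_in by (auto simp: F_def L_def fixed_cosets_def positive_cosets_def)
  qed
qed

text \<open>If the coset moved, it would be a positive coset and also the mirror image of one.
  Applied to both ends of an edge, this shows that an edge with positive representatives on both
  sides of the mirror is fixed.\<close>

lemma wall_fixes_coset:
  assumes H: "subgroup H G" and wall: "wall G H (s, pos)"
    and w: "w \<in> carrier G" "pos w" and v: "v \<in> carrier G" "pos v"
    and eq: "w <#\<^bsub>G\<^esub> H = s <#\<^bsub>G\<^esub> (v <#\<^bsub>G\<^esub> H)"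
  shows "s <#\<^bsub>G\<^esub> (w <#\<^bsub>G\<^esub> H) = w <#\<^bsub>G\<^esub> H"
proof (rule ccontr)
  note c = wall_cosets[OF H wall]
  assume ne: "s <#\<^bsub>G\<^esub> (w <#\<^bsub>G\<^esub> H) \<noteq> w <#\<^bsub>G\<^esub> H"
  then have "s <#\<^bsub>G\<^esub> (v <#\<^bsub>G\<^esub> H) \<noteq> v <#\<^bsub>G\<^esub> H" using eq by metis
  then have "v <#\<^bsub>G\<^esub> H \<in> positive_cosets G H s pos"
    using c(7)[OF v] unfolding fixed_cosets_def by blast
  then have "w <#\<^bsub>G\<^esub> H \<in> (\<lambda>X. s <#\<^bsub>G\<^esub> X) ` positive_cosets G H s pos"
    unfolding eq by (rule imageI)
  moreover have "w <#\<^bsub>G\<^esub> H \<in> positive_cosets G H s pos"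
    using c(7)[OF w] ne unfolding fixed_cosets_def by blast
  ultimately show False using c(6) by blast
qed

lemma Plus_Int: "(A <+> B) \<inter> (C <+> D) = (A \<inter> C) <+> (B \<inter> D)"
  by auto

lemma map_sum_Plus: "map_sum f g ` (A <+> B) = f ` A <+> g ` B"
  by (force simp: Plus_def image_Un image_image)

text \<open>The edge of \<open>w\<close> is reflected to the edge of \<open>s \<otimes> w\<close>,
  and both its ends inherit the sign of \<open>w\<close>. The second conjunct lets sequences of
  folds on edges be followed on group elements.\<close>

lemma Cauchy_Schwarz_pair_wall:
  assumes M: "prob_space M" and fin: "finite (carrier G)"
    and H: "subgroup H1 G" "subgroup H2 G" and walls: "wall G H1 a" "wall G H2 a"
  defines "\<Gamma> \<equiv> coset_graph G H1 H2"
  shows "\<exists>\<phi> \<phi>'. Cauchy_Schwarz_pair M (vertex_set \<Gamma>) (edge_set \<Gamma>) (\<lambda>e. Inl (fst e)) (\<lambda>e. Inr (snd e)) \<phi> \<phi>' \<and>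
    (\<forall>w\<in>carrier G. \<phi> (w <#\<^bsub>G\<^esub> H1, w <#\<^bsub>G\<^esub> H2) = (fold_across G a w <#\<^bsub>G\<^esub> H1, fold_across G a w <#\<^bsub>G\<^esub> H2))"
proof -
  obtain s pos where a: "a = (s, pos)" by (cases a)
  have s: "s \<in> carrier G" and pos: "\<And>w. w \<in> carrier G \<Longrightarrow> pos (s \<otimes> w) \<longleftrightarrow> \<not> pos w"
    using walls(1) by (auto simp: wall_def a)
  note c1 = wall_cosets[OF H(1) walls(1)[unfolded a]] and c2 = wall_cosets[OF H(2) walls(2)[unfolded a]]
  let ?F1 = "fixed_cosets G H1 s" and ?F2 = "fixed_cosets G H2 s"
  let ?L1 = "positive_cosets G H1 s pos" and ?L2 = "positive_cosets G H2 s pos"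
  define ew where "ew w = (w <#\<^bsub>G\<^esub> H1, w <#\<^bsub>G\<^esub> H2)" for w
  let ?\<sigma> = "map_sum (\<lambda>X. s <#\<^bsub>G\<^esub> X) (\<lambda>X. s <#\<^bsub>G\<^esub> X)"
  define \<tau> where "\<tau> = map_prod (\<lambda>X. s <#\<^bsub>G\<^esub> X) (\<lambda>X. s <#\<^bsub>G\<^esub> X)"
  let ?F = "?F1 <+> ?F2" and ?L = "?L1 <+> ?L2"
  define E where "E = ew ` carrier G"
  \<comment> \<open>\<open>EF\<close> requires both ends to be fixed. One moved end already puts an
    edge into \<open>EL\<close> or its mirror image, hence the ends of \<open>EL\<close> lie in
    fixed or positive cosets.\<close>
  define EF where "EF = {e \<in> E. \<tau> e = e}"
  define EL where "EL = {e \<in> E. \<tau> e \<noteq> e \<and> (\<exists>w\<in>carrier G. pos w \<and> e = ew w)}"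
  have V: "vertex_set \<Gamma> = ?F \<union> (?L \<union> ?\<sigma> ` ?L)"
  proof -
    have "vertex_set \<Gamma> = lcosets H1 <+> lcosets H2"
      by (simp add: \<Gamma>_def coset_graph_def vertex_set_def)
    also have "\<dots> = ?F \<union> (?L \<union> ?\<sigma> ` ?L)"
      unfolding c1(3) c2(3) by (simp add: Plus_def image_Un image_image) blast
    finally show ?thesis .
  qed
  have finV: "finite (vertex_set \<Gamma>)"
    using fin by (simp add: \<Gamma>_def coset_graph_def vertex_set_def LCOSETS_def)
  have edge: "edge_set \<Gamma> = E" by (simp add: \<Gamma>_def coset_graph_def E_def ew_def)
  have \<tau>: "\<tau> (ew w) = ew (s \<otimes> w)" if "w \<in> carrier G" for w
    using that c1(2) c2(2) by (simp add: ew_def \<tau>_def)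
  have in_lcosets: "w <#\<^bsub>G\<^esub> H1 \<in> lcosets H1" "w <#\<^bsub>G\<^esub> H2 \<in> lcosets H2" if "w \<in> carrier G" for w
    using that by (auto simp: LCOSETS_def)
  have \<tau>\<tau>: "\<tau> (\<tau> e) = e" if "e \<in> E" for e
    using that c1(1) c2(1) in_lcosets by (auto simp: E_def ew_def \<tau>_def)
  have \<tau>E: "\<tau> e \<in> E" if "e \<in> E" for e
    using that s \<tau> by (auto simp: E_def)
  have disj: "EL \<inter> \<tau> ` EL = {}"
  proof (rule ccontr)
    assume "EL \<inter> \<tau> ` EL \<noteq> {}"
    then obtain e where e: "e \<in> EL" "e \<in> \<tau> ` EL" by (meson disjoint_iff)
    from e(2) obtain e' where e': "e = \<tau> e'" "e' \<in> EL" by (rule imageE)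
    obtain w where W: "w \<in> carrier G" "pos w" "e = ew w" and ne: "\<tau> e \<noteq> e"
      using e(1) by (auto simp: EL_def)
    obtain v where V: "v \<in> carrier G" "pos v" "e' = ew v"
      using e'(2) by (auto simp: EL_def)
    have eq: "w <#\<^bsub>G\<^esub> H1 = s <#\<^bsub>G\<^esub> (v <#\<^bsub>G\<^esub> H1)" "w <#\<^bsub>G\<^esub> H2 = s <#\<^bsub>G\<^esub> (v <#\<^bsub>G\<^esub> H2)"
      using e'(1) W(3) V(3) by (simp_all add: ew_def \<tau>_def)
    have "\<tau> (ew w) = ew w"
      using wall_fixes_coset[OF H(1) walls(1)[unfolded a] W(1,2) V(1,2) eq(1)]
        wall_fixes_coset[OF H(2) walls(2)[unfolded a] W(1,2) V(1,2) eq(2)]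
      by (simp add: ew_def \<tau>_def)
    then show False using ne W(3) by simp
  qed
  have cover: "E = EF \<union> (EL \<union> \<tau> ` EL)"
  proof
    show "E \<subseteq> EF \<union> (EL \<union> \<tau> ` EL)"
    proof
      fix e assume e: "e \<in> E"
      then obtain w where w: "w \<in> carrier G" "e = ew w" by (auto simp: E_def)
      show "e \<in> EF \<union> (EL \<union> \<tau> ` EL)"
      proof (cases "\<tau> e = e \<or> pos w")
        case True then show ?thesis using e w by (auto simp: EF_def EL_def)
      next
        case False
        then have "pos (s \<otimes> w)" using pos w by blast
        then have "\<tau> e \<in> EL"
          using False e \<tau>E[OF e] \<tau>\<tau>[OF e] w s \<tau>[OF w(1)] by (auto simp: EL_def)
        then show ?thesis using \<tau>\<tau>[OF e] by (metis UnCI imageI)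
      qed
    qed
    show "EF \<union> (EL \<union> \<tau> ` EL) \<subseteq> E"
      using \<tau>E unfolding EF_def EL_def by blast
  qed
  have EFd: "EF \<inter> \<tau> ` EL = {}"
  proof -
    have "\<tau> e \<notin> EF" if "e \<in> EL" for e
      using that \<tau>\<tau>[of e] by (auto simp: EF_def EL_def)
    then show ?thesis by blast
  qed
  let ?\<phi> = "\<lambda>e. if e \<in> \<tau> ` EL then \<tau> e else e" and ?\<phi>' = "\<lambda>e. if e \<in> EL then \<tau> e else e"
  have finE: "finite E" using fin by (simp add: E_def)
  have ends: "fst e \<in> ?F1 \<union> ?L1" "snd e \<in> ?F2 \<union> ?L2" if e: "e \<in> EL" for e
  proof -
    obtain w where "w \<in> carrier G" "pos w" "e = ew w" using e by (auto simp: EL_def)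
    then show "fst e \<in> ?F1 \<union> ?L1" "snd e \<in> ?F2 \<union> ?L2"
      using c1(7)[of w] c2(7)[of w] by (simp_all add: ew_def)
  qed
  have ends': "fst e \<in> ?F1" "snd e \<in> ?F2" if "e \<in> EF" for e
    using that in_lcosets by (auto simp: EF_def E_def ew_def fixed_cosets_def \<tau>_def)
  have CS: "Cauchy_Schwarz_pair M (vertex_set \<Gamma>) E (\<lambda>e. Inl (fst e)) (\<lambda>e. Inr (snd e)) ?\<phi> ?\<phi>'"
    unfolding Cauchy_Schwarz_pair_def
  proof (intro conjI allI impI)
    show "?\<phi> ` E \<subseteq> E" "?\<phi>' ` E \<subseteq> E" using \<tau>E by (simp_all add: image_subset_iff)
    fix u :: "'a set \<times> 'a set \<Rightarrow> 'c \<times> 'c \<Rightarrow> ennreal"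
    assume u: "\<forall>e\<in>E. u e \<in> borel_measurable (M \<Otimes>\<^sub>M M)"
    show "(edge_integral M (vertex_set \<Gamma>) E (\<lambda>e. Inl (fst e)) (\<lambda>e. Inr (snd e)) u)\<^sup>2 \<le>
       edge_integral M (vertex_set \<Gamma>) E (\<lambda>e. Inl (fst e)) (\<lambda>e. Inr (snd e)) (u \<circ> ?\<phi>) *
       edge_integral M (vertex_set \<Gamma>) E (\<lambda>e. Inl (fst e)) (\<lambda>e. Inr (snd e)) (u \<circ> ?\<phi>')"
      unfolding comp_def
    proof (rule edge_integral_fold[OF M finV finE V _ _ _ _ _ cover _ EFd disj])
      show "?F \<inter> ?L = {}" "?F \<inter> ?\<sigma> ` ?L = {}" "?L \<inter> ?\<sigma> ` ?L = {}"
        unfolding Plus_Int map_sum_Plus c1(4,5,6) c2(4,5,6) by simp_all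
      show "?\<sigma> (?\<sigma> v) = v" if "v \<in> ?L" for v
        using that c1(1) c2(1) by (auto simp: positive_cosets_def)
      show "?\<sigma> v = v" if "v \<in> ?F" for v
        using that by (auto simp: fixed_cosets_def)
      show "EF \<inter> EL = {}" by (auto simp: EF_def EL_def)
      show "\<tau> (\<tau> e) = e" if "e \<in> EL" for e
        using that \<tau>\<tau> by (auto simp: EL_def)
      show "(\<lambda>e. Inl (fst e)) ` EF \<subseteq> ?F" "(\<lambda>e. Inr (snd e)) ` EF \<subseteq> ?F"
        using ends' by auto
      show "(\<lambda>e. Inl (fst e)) ` EL \<subseteq> ?F \<union> ?L" "(\<lambda>e. Inr (snd e)) ` EL \<subseteq> ?F \<union> ?L"
        using ends by auto
    qed (use u in \<open>auto simp: \<tau>_def\<close>)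
  qed
  \<comment> \<open>For a fixed edge the fold may still replace \<open>w\<close> by
    \<open>s \<otimes> w\<close>, but both represent the same edge.\<close>
  have "?\<phi> (ew w) = ew (fold_across G a w)" if w: "w \<in> carrier G" for w
  proof (cases "\<tau> (ew w) = ew w")
    case True
    then show ?thesis using \<tau>[OF w] by (auto simp: fold_across_def a)
  next
    case False
    show ?thesis
    proof (cases "pos w")
      case True
      then have "ew w \<in> EL" using False w by (auto simp: EL_def E_def)
      then have "ew w \<notin> \<tau> ` EL" using disj by blast
      then show ?thesis using True by (simp add: fold_across_def a)
    next
      case neg: False
      then have "\<tau> (ew w) \<in> EL"
        using False w s pos[OF w] \<tau>[OF w] \<tau>\<tau>[of "ew w"] by (auto simp: EL_def E_def)
      then have "ew w \<in> \<tau> ` EL"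
        using \<tau>\<tau>[of "ew w"] w by (metis E_def imageI)
      then show ?thesis using neg \<tau>[OF w] by (simp add: fold_across_def a)
    qed
  qed
  then show ?thesis using CS unfolding edge ew_def by blast
qed

end

context group
begin

text \<open>If the folds collapse the group to \<open>\<one>\<close>, their counterparts on edges
  collapse all edges to the edge of \<open>\<one>\<close>, which is the constancy that
  \<open>edge_Hoelder_if_constant_fold\<close> asks for.\<close>

lemma edge_Hoelder_coset_graph:
  assumes M: "prob_space M" and fin: "finite (carrier G)"
    and H: "subgroup H1 G" "subgroup H2 G"
    and walls: "\<And>a. a \<in> set as \<Longrightarrow> wall G H1 a" "\<And>a. a \<in> set as \<Longrightarrow> wall G H2 a"
    and const: "\<And>w. w \<in> carrier G \<Longrightarrow> foldr (fold_across G) as w = \<one>"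
  defines "\<Gamma> \<equiv> coset_graph G H1 H2"
  shows "edge_Hoelder M (vertex_set \<Gamma>) (edge_set \<Gamma>) (\<lambda>e. Inl (fst e)) (\<lambda>e. Inr (snd e))"
proof -
  let ?CS = "Cauchy_Schwarz_pair M (vertex_set \<Gamma>) (edge_set \<Gamma>) (\<lambda>e. Inl (fst e)) (\<lambda>e. Inr (snd e))"
  define ew where "ew w = (w <#\<^bsub>G\<^esub> H1, w <#\<^bsub>G\<^esub> H2)" for w
  have edge: "edge_set \<Gamma> = ew ` carrier G" by (simp add: \<Gamma>_def coset_graph_def ew_def)
  have "\<forall>a\<in>set as. \<exists>\<phi>. (\<exists>\<phi>'. ?CS \<phi> \<phi>') \<and> (\<forall>w\<in>carrier G. \<phi> (ew w) = ew (fold_across G a w))"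
  proof
    fix a assume "a \<in> set as"
    from Cauchy_Schwarz_pair_wall[OF M fin H walls(1)[OF this] walls(2)[OF this]]
    show "\<exists>\<phi>. (\<exists>\<phi>'. ?CS \<phi> \<phi>') \<and> (\<forall>w\<in>carrier G. \<phi> (ew w) = ew (fold_across G a w))"
      unfolding \<Gamma>_def ew_def by blast
  qed
  then obtain \<phi> where \<phi>: "\<forall>a\<in>set as. (\<exists>\<phi>'. ?CS (\<phi> a) \<phi>') \<and> (\<forall>w\<in>carrier G. \<phi> a (ew w) = ew (fold_across G a w))"
    by (rule bchoice[THEN exE])
  have closed: "fold_across G a w \<in> carrier G" if "a \<in> set as" "w \<in> carrier G" for a w
    using walls(1)[OF that(1)] that(2) by (cases a) (auto simp: fold_across_def wall_def)
  have "foldr (fold_across G) bs w \<in> carrier G \<and>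
      foldr (\<lambda>\<phi>. \<phi>) (map \<phi> bs) (ew w) = ew (foldr (fold_across G) bs w)"
    if "set bs \<subseteq> set as" "w \<in> carrier G" for bs w
    using that by (induction bs) (use \<phi> closed in auto)
  then have "foldr (\<lambda>\<phi>. \<phi>) (map \<phi> as) (ew w) = ew \<one>" if "w \<in> carrier G" for w
    using const that by simp
  then show ?thesis
    using fin \<phi> by (intro edge_Hoelder_if_constant_fold[OF M, of _ "map \<phi> as" _ _ _ "ew \<one>"])
      (auto simp: edge)
qed

end

section \<open>Finite reflection groups\<close>

lemma reflection_vec: "reflection \<alpha> *v v = v - (2 * (v \<bullet> \<alpha>) / (\<alpha> \<bullet> \<alpha>)) *\<^sub>R \<alpha>"
proof -
  have "linear (\<lambda>v. v - (2 * (v \<bullet> \<alpha>) / (\<alpha> \<bullet> \<alpha>)) *\<^sub>R \<alpha>)"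
    by (rule linearI) (simp_all add: inner_add_left scaleR_add_left add_divide_distrib algebra_simps)
  then show ?thesis
    unfolding reflection_def by (simp add: matrix_works)
qed

lemma reflection_unit: "norm \<alpha> = 1 \<Longrightarrow> reflection \<alpha> *v v = v - (2 * (v \<bullet> \<alpha>)) *\<^sub>R \<alpha>"
  by (simp add: reflection_vec dot_square_norm)

lemma reflection_self: "\<alpha> \<noteq> 0 \<Longrightarrow> reflection \<alpha> *v \<alpha> = - \<alpha>"
  by (simp add: reflection_vec scaleR_2)

lemma reflection_involution: "\<alpha> \<noteq> 0 \<Longrightarrow> reflection \<alpha> ** reflection \<alpha> = mat 1"
  by (simp add: matrix_eq flip: matrix_vector_mul_assoc)
    (simp add: reflection_vec inner_diff_left algebra_simps flip: scaleR_add_left)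

lemma reflection_scale: "c \<noteq> 0 \<Longrightarrow> reflection (c *\<^sub>R \<alpha>) = reflection \<alpha>"
  by (simp add: matrix_eq reflection_vec)

lemma reflection_uminus: "reflection (- \<alpha>) = reflection \<alpha>"
  using reflection_scale[of "-1" \<alpha>] by simp

text \<open>The rule would turn \<open>transpose A *v x\<close> into \<open>x v* A\<close>, but
  transposes are kept below: they are the inverses of the elements of \<open>W\<close>.\<close>

declare transpose_matrix_vector [simp del]

lemma inner_transpose:
  fixes A :: "real^'n^'n"
  shows "(transpose A *v x) \<bullet> y = x \<bullet> (A *v y)"
  by (metis dot_lmul_matrix transpose_transpose vector_transpose_matrix)

lemma transpose_reflection: "transpose (reflection \<alpha>) = reflection \<alpha>"
proof -
  have "(transpose (reflection \<alpha>) *v x) \<bullet> y = (reflection \<alpha> *v x) \<bullet> y" for x y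
    unfolding inner_transpose by (simp add: reflection_vec inner_diff_left inner_diff_right inner_commute)
  then have "transpose (reflection \<alpha>) *v x = reflection \<alpha> *v x" for x
    using vector_eq_rdot by blast
  then show ?thesis by (simp add: matrix_eq)
qed

lemma orthogonal_matrix_reflection: "\<alpha> \<noteq> 0 \<Longrightarrow> orthogonal_matrix (reflection \<alpha>)"
  by (simp add: orthogonal_matrix_def transpose_reflection reflection_involution)

lemma orthogonal_matrix_inner:
  fixes Q :: "real^'n^'n"
  shows "orthogonal_matrix Q \<Longrightarrow> (Q *v x) \<bullet> (Q *v y) = x \<bullet> y"
  by (metis inner_transpose matrix_vector_mul_assoc matrix_vector_mul_lid orthogonal_matrix_def)

lemma reflection_conj:
  assumes Q: "orthogonal_matrix Q"
  shows "Q ** reflection \<alpha> ** transpose Q = reflection (Q *v \<alpha>)"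
proof -
  have QQ: "Q *v (transpose Q *v v) = v" for v
    using Q by (simp add: matrix_vector_mul_assoc orthogonal_matrix_def)
  have "Q *v (reflection \<alpha> *v (transpose Q *v v)) = reflection (Q *v \<alpha>) *v v" for v
    using Q by (simp add: reflection_vec matrix_vector_mult_diff_distrib QQ inner_transpose
        orthogonal_matrix_inner matrix_vector_mult_scaleR)
  then show ?thesis by (simp add: matrix_eq flip: matrix_vector_mul_assoc)
qed

lemma group_GL: "group (GL :: (real^'n^'n) monoid)"
proof (rule groupI)
  fix x :: "real^'n^'n" assume "x \<in> carrier GL"
  then obtain y where "x ** y = mat 1" "y ** x = mat 1" by (auto simp: GL_def invertible_def)
  then show "\<exists>y\<in>carrier GL. y \<otimes>\<^bsub>GL\<^esub> x = \<one>\<^bsub>GL\<^esub>" by (auto simp: GL_def invertible_def)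
next
  show "\<one>\<^bsub>GL\<^esub> \<in> carrier (GL :: (real^'n^'n) monoid)"
    by (auto simp: GL_def invertible_def intro: exI[of _ "mat 1"])
qed (auto simp: GL_def invertible_mult matrix_mul_assoc)

lemma GL_inv_orthogonal:
  fixes w :: "real^'n^'n"
  assumes "orthogonal_matrix w" shows "inv\<^bsub>GL\<^esub> w = transpose w"
proof -
  interpret group "GL :: (real^'n^'n) monoid" by (rule group_GL)
  show ?thesis
    using assms by (intro inv_equality) (auto simp: GL_def orthogonal_matrix_def invertible_def)
qed

section \<open>The lexicographic order of an ordered basis\<close>

lemma lex_positive_add:
  assumes "lex_positive u \<alpha>" "lex_positive u \<beta>"
  shows "lex_positive u (\<alpha> + \<beta>)"
proof -
  obtain c k where c: "\<alpha> = (\<Sum>i<length u. c i *\<^sub>R u ! i)" "k < length u" "c k > 0" "\<forall>i<k. c i = 0"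
    using assms(1) by (auto simp: lex_positive_def)
  obtain d l where d: "\<beta> = (\<Sum>i<length u. d i *\<^sub>R u ! i)" "l < length u" "d l > 0" "\<forall>i<l. d i = 0"
    using assms(2) by (auto simp: lex_positive_def)
  have "\<alpha> + \<beta> = (\<Sum>i<length u. (c i + d i) *\<^sub>R u ! i)"
    by (simp add: c(1) d(1) scaleR_add_left sum.distrib)
  moreover have "c (min k l) + d (min k l) > 0"
    using c d by (cases k l rule: linorder_cases) (auto simp: min_def)
  ultimately show ?thesis
    unfolding lex_positive_def using c(2,4) d(2,4)
    by (intro exI[of _ "\<lambda>i. c i + d i"] conjI exI[of _ "min k l"]) auto
qed

lemma lex_positive_scaleR:
  assumes "lex_positive u \<alpha>" "a > 0"
  shows "lex_positive u (a *\<^sub>R \<alpha>)"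
proof -
  obtain c k where c: "\<alpha> = (\<Sum>i<length u. c i *\<^sub>R u ! i)" "k < length u" "c k > 0" "\<forall>i<k. c i = 0"
    using assms(1) by (auto simp: lex_positive_def)
  then have "a *\<^sub>R \<alpha> = (\<Sum>i<length u. (a * c i) *\<^sub>R u ! i)"
    by (simp add: scaleR_sum_right)
  then show ?thesis
    unfolding lex_positive_def using c(2-4) assms(2)
    by (intro exI[of _ "\<lambda>i. a * c i"] conjI exI[of _ k]) auto
qed

text \<open>With \<open>not_lex_positive_0\<close> it follows that a non-negative combination of
  positive vectors vanishes only trivially.\<close>

lemma lex_positive_sum:
  assumes "finite A" "\<And>\<alpha>. \<alpha> \<in> A \<Longrightarrow> lex_positive u \<alpha>" "\<And>\<alpha>. \<alpha> \<in> A \<Longrightarrow> 0 \<le> a \<alpha>"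
  shows "(\<forall>\<alpha>\<in>A. a \<alpha> = 0) \<or> lex_positive u (\<Sum>\<alpha>\<in>A. a \<alpha> *\<^sub>R \<alpha>)"
  using assms
proof (induction A)
  case (insert \<beta> A)
  have IH: "(\<forall>\<alpha>\<in>A. a \<alpha> = 0) \<or> lex_positive u (\<Sum>\<alpha>\<in>A. a \<alpha> *\<^sub>R \<alpha>)"
    using insert by auto
  have "a \<beta> = 0 \<or> lex_positive u (a \<beta> *\<^sub>R \<beta>)"
    using lex_positive_scaleR[of u \<beta> "a \<beta>"] insert.prems[of \<beta>] by force
  moreover have "(\<Sum>\<alpha>\<in>A. a \<alpha> *\<^sub>R \<alpha>) = 0" if "\<forall>\<alpha>\<in>A. a \<alpha> = 0"
    using that by simp
  ultimately show ?case
    using IH insert.hyps lex_positive_add by auto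
qed simp

text \<open>\<open>lex_positive\<close> asks for some coefficients; independence of the basis leaves
  only the zero coefficients for the vector 0.\<close>

lemma not_lex_positive_0:
  assumes "ordered_basis u" shows "\<not> lex_positive u 0"
proof
  assume "lex_positive u 0"
  then obtain c k where c: "(\<Sum>i<length u. c i *\<^sub>R u ! i) = 0" "k < length u" "c k > 0"
    by (auto simp: lex_positive_def)
  have inj: "inj_on ((!) u) {..<length u}" and indep: "independent (set u)"
    using assms by (auto simp: ordered_basis_def inj_on_nth)
  have img: "(!) u ` {..<length u} = set u" by (auto simp: set_conv_nth)
  define d where "d v = c (the_inv_into {..<length u} ((!) u) v)" for v
  have d: "d (u ! i) = c i" if "i < length u" for i
    using the_inv_into_f_f[OF inj, of i] that by (simp add: d_def)
  have "(\<Sum>v\<in>set u. d v *\<^sub>R v) = (\<Sum>i<length u. c i *\<^sub>R u ! i)"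
    unfolding img[symmetric] sum.reindex[OF inj] by (simp add: d)
  then have "d (u ! k) = 0"
    using independentD[OF indep, of "set u" d "u ! k"] c by simp
  then show False using c d by simp
qed

lemma lex_positive_total:
  assumes "ordered_basis u" "\<alpha> \<noteq> 0"
  shows "lex_positive u \<alpha> \<or> lex_positive u (- \<alpha>)"
proof -
  have inj: "inj_on ((!) u) {..<length u}" and "\<alpha> \<in> span (set u)"
    using assms by (auto simp: ordered_basis_def inj_on_nth)
  then obtain r where "\<alpha> = (\<Sum>v\<in>set u. r v *\<^sub>R v)"
    by (auto simp: span_finite)
  moreover have img: "(!) u ` {..<length u} = set u" by (auto simp: set_conv_nth)
  ultimately have \<alpha>: "\<alpha> = (\<Sum>i<length u. r (u ! i) *\<^sub>R u ! i)"
    unfolding img[symmetric] sum.reindex[OF inj] by simp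
  then have "\<exists>k. k < length u \<and> r (u ! k) \<noteq> 0"
    using assms(2) by (metis (no_types, lifting) lessThan_iff scaleR_zero_left sum.neutral)
  then obtain k where k: "k < length u" "r (u ! k) \<noteq> 0" "\<forall>i<k. r (u ! i) = 0"
    using exists_least_iff[of "\<lambda>k. k < length u \<and> r (u ! k) \<noteq> 0"] by (metis order.strict_trans)
  have \<alpha>': "- \<alpha> = (\<Sum>i<length u. (- r (u ! i)) *\<^sub>R u ! i)"
    using \<alpha> by (simp add: sum_negf)
  show ?thesis
  proof (cases "r (u ! k) > 0")
    case True
    then show ?thesis unfolding lex_positive_def using \<alpha> k by (intro disjI1 exI[of _ "\<lambda>i. r (u ! i)"]) auto
  next
    case False
    then have "- r (u ! k) > 0" using k(2) by simp
    then show ?thesis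
      unfolding lex_positive_def using \<alpha>' k by (intro disjI2 exI[of _ "\<lambda>i. - r (u ! i)"]) auto
  qed
qed

section \<open>Roots and simple systems\<close>

lemma finite_roots:
  fixes W :: "(real^'n^'n) set"
  assumes "finite W" shows "finite (roots W)"
proof -
  have "roots W \<subseteq> (\<Union>w\<in>W. {\<alpha>. norm \<alpha> = 1 \<and> reflection \<alpha> = w})"
    by (auto simp: roots_def)
  moreover have "finite {\<alpha>. norm \<alpha> = 1 \<and> reflection \<alpha> = w}" for w :: "real^'n^'n"
  proof (cases "\<exists>\<beta>. norm \<beta> = 1 \<and> reflection \<beta> = w")
    case True
    then obtain \<beta> where \<beta>: "norm \<beta> = 1" "reflection \<beta> = w" by blast
    \<comment> \<open>Evaluating the common reflection at \<alpha> shows that \<alpha> is a multiple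
      of \<beta>, and both are unit vectors.\<close>
    have "\<alpha> = \<beta> \<or> \<alpha> = - \<beta>" if "norm \<alpha> = 1" "reflection \<alpha> = w" for \<alpha>
    proof -
      have "reflection \<alpha> *v \<alpha> = reflection \<beta> *v \<alpha>" using that \<beta> by simp
      then have "2 *\<^sub>R \<alpha> = 2 *\<^sub>R ((\<alpha> \<bullet> \<beta>) *\<^sub>R \<beta>)"
        using that(1) \<beta>(1) by (simp add: reflection_unit dot_square_norm algebra_simps)
      then have eq: "\<alpha> = (\<alpha> \<bullet> \<beta>) *\<^sub>R \<beta>"
        by (simp del: scaleR_scaleR)
      then have "\<bar>\<alpha> \<bullet> \<beta>\<bar> = 1" using that \<beta> by (metis mult.right_neutral norm_scaleR)
      then have "\<alpha> \<bullet> \<beta> = 1 \<or> \<alpha> \<bullet> \<beta> = -1" by linarith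
      then show ?thesis using eq by (metis scaleR_minus1_left scaleR_one)
    qed
    then have "{\<alpha>. norm \<alpha> = 1 \<and> reflection \<alpha> = w} \<subseteq> {\<beta>, - \<beta>}" by auto
    then show ?thesis by (rule finite_subset) simp
  next
    case False
    then have "{\<alpha>. norm \<alpha> = 1 \<and> reflection \<alpha> = w} = {}" by auto
    then show ?thesis by (simp only: finite.emptyI)
  qed
  ultimately show ?thesis
    using assms by (meson finite_UN_I finite_subset)
qed

text \<open>The facts about a simple system that the group theory rests on, freed from the ordered
  basis. \<open>pointed\<close> records that positive combinations do not cancel,
  \<open>irredundant\<close> the minimality of \<open>\<Delta>\<close>; together they do the work of
  linear independence.\<close>

locale simple_roots =
  fixes W :: "(real^'n^'n) set" and P \<Delta> :: "(real^'n) set"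
  assumes W: "finite_reflection_group W"
    and P_roots: "P \<subseteq> roots W"
    and P_total: "\<And>\<alpha>. \<alpha> \<in> roots W \<Longrightarrow> \<alpha> \<in> P \<or> - \<alpha> \<in> P"
    and P_disj: "\<And>\<alpha>. \<alpha> \<in> P \<Longrightarrow> - \<alpha> \<notin> P"
    and \<Delta>_P: "\<Delta> \<subseteq> P"
    and P_gen: "\<And>\<beta>. \<beta> \<in> P \<Longrightarrow> \<exists>a. (\<forall>\<alpha>\<in>\<Delta>. 0 \<le> a \<alpha>) \<and> \<beta> = (\<Sum>\<alpha>\<in>\<Delta>. a \<alpha> *\<^sub>R \<alpha>)"
    and pointed: "\<And>a \<alpha>. \<forall>\<alpha>\<in>\<Delta>. 0 \<le> a \<alpha> \<Longrightarrow> (\<Sum>\<alpha>\<in>\<Delta>. a \<alpha> *\<^sub>R \<alpha>) = 0 \<Longrightarrow> \<alpha> \<in> \<Delta> \<Longrightarrow> a \<alpha> = (0::real)"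
    and irredundant: "\<And>a \<alpha>. \<alpha> \<in> \<Delta> \<Longrightarrow> \<forall>\<gamma>\<in>\<Delta> - {\<alpha>}. 0 \<le> a \<gamma> \<Longrightarrow> \<alpha> \<noteq> (\<Sum>\<gamma>\<in>\<Delta> - {\<alpha>}. a \<gamma> *\<^sub>R \<gamma>)"
begin

lemma root_norm: "\<alpha> \<in> roots W \<Longrightarrow> norm \<alpha> = 1" and root_nz: "\<alpha> \<in> roots W \<Longrightarrow> \<alpha> \<noteq> 0"
  and root_W: "\<alpha> \<in> roots W \<Longrightarrow> reflection \<alpha> \<in> W"
  by (auto simp: roots_def)

lemma P_root: "\<alpha> \<in> P \<Longrightarrow> \<alpha> \<in> roots W" and \<Delta>_root: "\<alpha> \<in> \<Delta> \<Longrightarrow> \<alpha> \<in> roots W" and \<Delta>_in_P: "\<alpha> \<in> \<Delta> \<Longrightarrow> \<alpha> \<in> P"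
  using P_roots \<Delta>_P by auto

lemma subgroup_W: "subgroup W GL" and finite_W: "finite W"
  using W by (auto simp: finite_reflection_group_def)

lemma one_W: "mat 1 \<in> W" and mult_W: "v \<in> W \<Longrightarrow> w \<in> W \<Longrightarrow> v ** w \<in> W"
  using subgroup.one_closed[OF subgroup_W] subgroup.m_closed[OF subgroup_W] by (auto simp: GL_def)

lemma W_induct [consumes 1, case_names one mult]:
  assumes "w \<in> W" and one: "Q (mat 1)"
    and mult: "\<And>\<alpha> v. \<alpha> \<in> roots W \<Longrightarrow> v \<in> W \<Longrightarrow> Q v \<Longrightarrow> Q (reflection \<alpha> ** v)"
  shows "Q w"
proof -
  obtain R where R: "R \<subseteq> reflections" "W = generate GL R"
    using W by (auto simp: finite_reflection_group_def)
  have R_root: "\<exists>\<alpha>\<in>roots W. r = reflection \<alpha>" if r: "r \<in> R" for r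
  proof -
    obtain \<alpha> where \<alpha>: "\<alpha> \<noteq> 0" "r = reflection \<alpha>" using r R(1) by (auto simp: reflections_def)
    have "r \<in> W" using r R(2) by (auto intro: generate.incl)
    then have "(1 / norm \<alpha>) *\<^sub>R \<alpha> \<in> roots W" "r = reflection ((1 / norm \<alpha>) *\<^sub>R \<alpha>)"
      using \<alpha> reflection_scale[of "1 / norm \<alpha>" \<alpha>] by (auto simp: roots_def)
    then show ?thesis by blast
  qed
  \<comment> \<open>\<open>generate\<close> builds products in any bracketing, while the rule peels
    off one reflection on the left. Stating that left multiplication by \<open>w\<close> preserves
    \<open>Q\<close> makes products compose.\<close>
  have "\<forall>v\<in>W. Q v \<longrightarrow> w ** v \<in> W \<and> Q (w ** v)"
    using \<open>w \<in> W\<close> unfolding R(2)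
  proof (induction rule: generate.induct)
    case one then show ?case by (simp add: GL_def)
  next
    case (incl h)
    then show ?case using R_root[of h] mult mult_W root_W R(2) by blast
  next
    case (inv h)
    then obtain \<alpha> where "\<alpha> \<in> roots W" "h = reflection \<alpha>" using R_root[of h] by blast
    moreover from this have "inv\<^bsub>GL\<^esub> h = h"
      by (simp add: GL_inv_orthogonal orthogonal_matrix_reflection transpose_reflection root_nz)
    ultimately show ?case using mult mult_W root_W R(2) by auto
  next
    case (eng h1 h2)
    then show ?case by (auto simp: GL_def simp flip: matrix_mul_assoc)
  qed
  then show ?thesis using one one_W by (metis matrix_mul_rid)
qed

lemma W_orthogonal: "w \<in> W \<Longrightarrow> orthogonal_matrix w"
  by (induction rule: W_induct)
    (auto simp: orthogonal_matrix_id dest: root_nz intro!: orthogonal_matrix_mul orthogonal_matrix_reflection)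

lemma transpose_W: "w \<in> W \<Longrightarrow> transpose w \<in> W"
  using subgroup.m_inv_closed[OF subgroup_W, of w] GL_inv_orthogonal[OF W_orthogonal] by simp

lemma W_cancel: "w \<in> W \<Longrightarrow> transpose w ** w = mat 1" "w \<in> W \<Longrightarrow> w ** transpose w = mat 1"
  using W_orthogonal by (auto simp: orthogonal_matrix_def)

lemma W_conj: "w \<in> W \<Longrightarrow> w ** reflection \<alpha> ** transpose w = reflection (w *v \<alpha>)"
  by (intro reflection_conj W_orthogonal)

lemma W_root: "w \<in> W \<Longrightarrow> \<alpha> \<in> roots W \<Longrightarrow> w *v \<alpha> \<in> roots W"
  using W_conj[of w \<alpha>] orthogonal_matrix_inner[OF W_orthogonal, of w \<alpha> \<alpha>]
    mult_W[OF mult_W[of w "reflection \<alpha>"], of "transpose w"] transpose_W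
  by (simp add: roots_def norm_eq_1)

lemma reflection_cancel: "\<alpha> \<in> roots W \<Longrightarrow> reflection \<alpha> ** (reflection \<alpha> ** v) = v"
  by (simp add: matrix_mul_assoc reflection_involution root_nz)

lemma not_P_iff: "\<alpha> \<in> roots W \<Longrightarrow> \<alpha> \<notin> P \<longleftrightarrow> - \<alpha> \<in> P"
  using P_total[of \<alpha>] P_disj[of \<alpha>] P_disj[of "- \<alpha>"] by auto

lemma finite_P: "finite P"
  using finite_roots[OF finite_W] P_roots by (rule finite_subset[rotated])

lemma finite_\<Delta>: "finite \<Delta>"
  using finite_P \<Delta>_P by (rule finite_subset[rotated])

text \<open>Otherwise add the non-negative expansions of \<beta> and of minus its image: the sum is
  a multiple of \<alpha>, so the part off \<alpha> equals \<open>c *\<^sub>R \<alpha>\<close>. If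
  \<open>c > 0\<close>, \<alpha> is redundant in \<open>\<Delta>\<close>; if
  \<open>c \<le> 0\<close>, pointedness kills all coefficients off \<alpha>, and \<beta> is the unit
  vector \<alpha>.\<close>

lemma simple_reflection_P:
  assumes \<alpha>: "\<alpha> \<in> \<Delta>" and \<beta>: "\<beta> \<in> P" "\<beta> \<noteq> \<alpha>"
  shows "reflection \<alpha> *v \<beta> \<in> P"
proof (rule ccontr)
  assume "reflection \<alpha> *v \<beta> \<notin> P"
  then have "- (reflection \<alpha> *v \<beta>) \<in> P"
    using not_P_iff W_root root_W \<Delta>_root P_root \<alpha> \<beta> by blast
  then obtain b where b: "\<forall>\<gamma>\<in>\<Delta>. 0 \<le> b \<gamma>" "- (reflection \<alpha> *v \<beta>) = (\<Sum>\<gamma>\<in>\<Delta>. b \<gamma> *\<^sub>R \<gamma>)"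
    using P_gen by blast
  obtain a where a: "\<forall>\<gamma>\<in>\<Delta>. 0 \<le> a \<gamma>" "\<beta> = (\<Sum>\<gamma>\<in>\<Delta>. a \<gamma> *\<^sub>R \<gamma>)"
    using P_gen[OF \<beta>(1)] by blast
  define c where "c = 2 * (\<beta> \<bullet> \<alpha>) - a \<alpha> - b \<alpha>"
  let ?s = "\<Sum>\<gamma>\<in>\<Delta> - {\<alpha>}. (a \<gamma> + b \<gamma>) *\<^sub>R \<gamma>"
  have "(\<Sum>\<gamma>\<in>\<Delta>. (a \<gamma> + b \<gamma>) *\<^sub>R \<gamma>) = \<beta> - reflection \<alpha> *v \<beta>"
    using a(2) b(2) by (simp add: scaleR_add_left sum.distrib)
  also have "\<dots> = (2 * (\<beta> \<bullet> \<alpha>)) *\<^sub>R \<alpha>"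
    using \<alpha> \<Delta>_root root_norm by (simp add: reflection_unit)
  finally have "(a \<alpha> + b \<alpha>) *\<^sub>R \<alpha> + ?s = (2 * (\<beta> \<bullet> \<alpha>)) *\<^sub>R \<alpha>"
    using \<alpha> finite_\<Delta> by (simp add: sum.remove)
  then have s: "?s = c *\<^sub>R \<alpha>"
    unfolding c_def by (simp add: scaleR_diff_left scaleR_add_left algebra_simps)
  show False
  proof (cases "c > 0")
    case True
    then have "\<alpha> = (1 / c) *\<^sub>R ?s" using s by simp
    also have "\<dots> = (\<Sum>\<gamma>\<in>\<Delta> - {\<alpha>}. ((a \<gamma> + b \<gamma>) / c) *\<^sub>R \<gamma>)"
      by (simp add: scaleR_sum_right)
    finally show False using irredundant[OF \<alpha>, of "\<lambda>\<gamma>. (a \<gamma> + b \<gamma>) / c"] a(1) b(1) True by simp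
  next
    case False
    define d where "d \<gamma> = (if \<gamma> = \<alpha> then - c else a \<gamma> + b \<gamma>)" for \<gamma>
    have "(\<Sum>\<gamma>\<in>\<Delta>. d \<gamma> *\<^sub>R \<gamma>) = d \<alpha> *\<^sub>R \<alpha> + (\<Sum>\<gamma>\<in>\<Delta> - {\<alpha>}. d \<gamma> *\<^sub>R \<gamma>)"
      using \<alpha> finite_\<Delta> by (simp add: sum.remove)
    also have "(\<Sum>\<gamma>\<in>\<Delta> - {\<alpha>}. d \<gamma> *\<^sub>R \<gamma>) = ?s"
      by (intro sum.cong) (auto simp: d_def)
    finally have "(\<Sum>\<gamma>\<in>\<Delta>. d \<gamma> *\<^sub>R \<gamma>) = 0" using s by (simp add: d_def)
    moreover have "\<forall>\<gamma>\<in>\<Delta>. 0 \<le> d \<gamma>" using a(1) b(1) False by (simp add: d_def)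
    ultimately have d0: "d \<gamma> = 0" if "\<gamma> \<in> \<Delta>" for \<gamma> using pointed that by blast
    have "a \<gamma> = 0" if "\<gamma> \<in> \<Delta> - {\<alpha>}" for \<gamma>
    proof -
      have "a \<gamma> + b \<gamma> = 0" "0 \<le> a \<gamma>" "0 \<le> b \<gamma>"
        using that d0[of \<gamma>] a(1) b(1) by (auto simp: d_def)
      then show ?thesis by linarith
    qed
    then have "\<beta> = a \<alpha> *\<^sub>R \<alpha>"
      using a(2) \<alpha> finite_\<Delta> by (simp add: sum.remove)
    moreover have "norm \<beta> = 1" "norm \<alpha> = 1" "0 \<le> a \<alpha>"
      using root_norm P_root \<Delta>_root \<alpha> \<beta> a(1) by auto
    ultimately have "\<beta> = \<alpha>" by simp
    then show False using \<beta> by simp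
  qed
qed

section \<open>Words in the simple reflections\<close>

inductive word :: "nat \<Rightarrow> real^'n^'n \<Rightarrow> bool" where
  word_one: "word 0 (mat 1)"
| word_Suc: "\<alpha> \<in> \<Delta> \<Longrightarrow> word k w \<Longrightarrow> word (Suc k) (reflection \<alpha> ** w)"

lemma word_W: "word k w \<Longrightarrow> w \<in> W"
  by (induction rule: word.induct) (auto intro: one_W mult_W root_W \<Delta>_root)

lemma word_mult: "word k w \<Longrightarrow> word l v \<Longrightarrow> word (k + l) (w ** v)"
  by (induction rule: word.induct) (auto intro: word.intros simp flip: matrix_mul_assoc)

text \<open>Take a counterexample \<beta> of least height. As \<beta> is a non-negative combination
  of simple roots and has positive square, some simple \<gamma> has a positive inner product with
  it. Reflecting in \<gamma> gives a positive root of smaller height, and conjugating its word by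
  \<gamma> yields one for \<beta>.\<close>

lemma reflection_word:
  assumes "\<beta> \<in> P" shows "\<exists>k. word k (reflection \<beta>)"
proof (rule ccontr)
  \<comment> \<open>The functional \<open>\<rho>\<close> serves as a height of roots: it is 1 on every simple root.\<close>
  let ?\<rho> = "\<Sum>P"
  let ?B = "{\<beta> \<in> P. \<nexists>k. word k (reflection \<beta>)}"
  assume "\<nexists>k. word k (reflection \<beta>)"
  then have "?B \<noteq> {}" "finite ?B" using assms finite_P by auto
  then obtain \<beta> where \<beta>: "\<beta> \<in> ?B" and min: "\<And>\<beta>'. \<beta>' \<in> ?B \<Longrightarrow> ?\<rho> \<bullet> \<beta> \<le> ?\<rho> \<bullet> \<beta>'"
    using ex_min_if_finite[of "(\<lambda>\<beta>. ?\<rho> \<bullet> \<beta>) ` ?B"] by (force simp: not_less)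
  \<comment> \<open>The reflection in \<gamma> permutes the other positive roots and negates
    \<gamma>, so it subtracts 2 \<gamma> from the sum; comparison with the formula for a unit normal
    gives the value 1.\<close>
  have \<rho>: "?\<rho> \<bullet> \<gamma> = 1" if \<gamma>: "\<gamma> \<in> \<Delta>" for \<gamma>
  proof -
    have \<gamma>1: "norm \<gamma> = 1" using \<gamma> \<Delta>_root root_norm by blast
    have inj: "inj_on (\<lambda>\<beta>. reflection \<gamma> *v \<beta>) (P - {\<gamma>})"
      by (rule inj_onI) (metis \<gamma> \<Delta>_root matrix_vector_mul_assoc matrix_vector_mul_lid reflection_involution root_nz)
    have invol: "reflection \<gamma> *v (reflection \<gamma> *v x) = x" for x
      using \<gamma> \<Delta>_root root_nz by (simp add: matrix_vector_mul_assoc reflection_involution)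
    have self: "reflection \<gamma> *v \<gamma> = - \<gamma>"
      using \<gamma> \<Delta>_root root_nz reflection_self by blast
    have "(\<lambda>\<beta>. reflection \<gamma> *v \<beta>) ` (P - {\<gamma>}) \<subseteq> P - {\<gamma>}"
    proof
      fix x assume "x \<in> (\<lambda>\<beta>. reflection \<gamma> *v \<beta>) ` (P - {\<gamma>})"
      then obtain \<delta> where \<delta>: "\<delta> \<in> P" "\<delta> \<noteq> \<gamma>" "x = reflection \<gamma> *v \<delta>" by blast
      moreover have "x \<noteq> \<gamma>"
      proof
        assume "x = \<gamma>"
        then have "\<delta> = - \<gamma>" using \<delta>(3) invol[of \<delta>] self by simp
        then show False using \<delta>(1) \<gamma> P_disj \<Delta>_in_P by blast
      qed
      ultimately show "x \<in> P - {\<gamma>}" using simple_reflection_P[OF \<gamma>] by blast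
    qed
    then have img: "(\<lambda>\<beta>. reflection \<gamma> *v \<beta>) ` (P - {\<gamma>}) = P - {\<gamma>}"
      using inj finite_P by (intro card_subset_eq) (auto simp: card_image)
    have \<rho>': "?\<rho> = \<gamma> + \<Sum>(P - {\<gamma>})"
      using sum.remove[OF finite_P \<Delta>_in_P[OF \<gamma>], of "\<lambda>x. x"] by simp
    have "reflection \<gamma> *v \<Sum>(P - {\<gamma>}) = (\<Sum>\<beta>\<in>P - {\<gamma>}. reflection \<gamma> *v \<beta>)"
      by (rule linear_sum) simp
    also have "\<dots> = \<Sum>((\<lambda>\<beta>. reflection \<gamma> *v \<beta>) ` (P - {\<gamma>}))"
      using sum.reindex[OF inj, of id] by simp
    finally have "reflection \<gamma> *v ?\<rho> = - \<gamma> + \<Sum>(P - {\<gamma>})"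
      unfolding \<rho>' img by (simp add: matrix_vector_right_distrib self)
    then have "(2 * (?\<rho> \<bullet> \<gamma>)) *\<^sub>R \<gamma> = 2 *\<^sub>R \<gamma>"
      using \<gamma>1 \<rho>' by (simp add: reflection_unit scaleR_2 algebra_simps)
    then show ?thesis using \<gamma>1 by (auto dest!: scaleR_right_imp_eq)
  qed
  have \<beta>P: "\<beta> \<in> P" using \<beta> by simp
  then obtain a where a: "\<forall>\<gamma>\<in>\<Delta>. 0 \<le> a \<gamma>" "\<beta> = (\<Sum>\<gamma>\<in>\<Delta>. a \<gamma> *\<^sub>R \<gamma>)" using P_gen by blast
  have "\<exists>\<gamma>\<in>\<Delta>. \<gamma> \<bullet> \<beta> > 0"
  proof (rule ccontr)
    assume "\<not> (\<exists>\<gamma>\<in>\<Delta>. \<gamma> \<bullet> \<beta> > 0)"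
    then have "(\<Sum>\<gamma>\<in>\<Delta>. a \<gamma> * (\<gamma> \<bullet> \<beta>)) \<le> 0"
      using a(1) by (intro sum_nonpos) (auto simp: mult_nonneg_nonpos not_less)
    moreover have "\<beta> \<bullet> \<beta> = (\<Sum>\<gamma>\<in>\<Delta>. a \<gamma> * (\<gamma> \<bullet> \<beta>))"
      by (subst (1) a(2)) (simp add: inner_sum_left)
    moreover have "\<beta> \<bullet> \<beta> = 1" using \<beta>P P_root root_norm norm_eq_1 by blast
    ultimately show False by simp
  qed
  then obtain \<gamma> where \<gamma>: "\<gamma> \<in> \<Delta>" "\<gamma> \<bullet> \<beta> > 0" by blast
  have "word 1 (reflection \<gamma>)" using word_Suc[OF \<gamma>(1) word_one] by simp
  then have ne: "\<beta> \<noteq> \<gamma>" using \<beta> by auto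
  let ?\<beta>' = "reflection \<gamma> *v \<beta>"
  have P': "?\<beta>' \<in> P" using simple_reflection_P[OF \<gamma>(1) \<beta>P ne] .
  have \<gamma>r: "\<gamma> \<in> roots W" using \<gamma> \<Delta>_root by blast
  have "?\<beta>' = \<beta> - (2 * (\<beta> \<bullet> \<gamma>)) *\<^sub>R \<gamma>" using \<gamma>r root_norm by (simp add: reflection_unit)
  then have "?\<rho> \<bullet> ?\<beta>' = ?\<rho> \<bullet> \<beta> - 2 * (\<beta> \<bullet> \<gamma>)" using \<rho>[OF \<gamma>(1)] by (simp add: inner_diff_right)
  then have "?\<rho> \<bullet> ?\<beta>' < ?\<rho> \<bullet> \<beta>" using \<gamma>(2) by (simp add: inner_commute)
  then have "?\<beta>' \<notin> ?B" using min[of ?\<beta>'] by force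
  then obtain k where k: "word k (reflection ?\<beta>')" using P' by blast
  have "reflection ?\<beta>' = reflection \<gamma> ** reflection \<beta> ** reflection \<gamma>"
    using W_conj[OF root_W[OF \<gamma>r], of \<beta>] by (simp add: transpose_reflection)
  then have "reflection \<beta> = reflection \<gamma> ** reflection ?\<beta>' ** reflection \<gamma>"
    using reflection_involution[OF root_nz[OF \<gamma>r]]
    by (simp add: reflection_cancel[OF \<gamma>r] flip: matrix_mul_assoc)
  then have "word (1 + k + 1) (reflection \<beta>)"
    using word_mult[OF word_mult[OF \<open>word 1 (reflection \<gamma>)\<close> k] \<open>word 1 (reflection \<gamma>)\<close>] by simp
  then show False using \<beta> by blast
qed

lemma W_word: "w \<in> W \<Longrightarrow> \<exists>k. word k w"
proof (induction rule: W_induct)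
  case one then show ?case using word_one by blast
next
  case (mult \<alpha> v)
  have "\<exists>k. word k (reflection \<alpha>)"
    using P_total[OF mult(1)] reflection_word[of \<alpha>] reflection_word[of "- \<alpha>"]
    by (auto simp: reflection_uminus)
  then show ?case using mult word_mult by blast
qed

text \<open>The exchange condition. Follow \<beta> along the word: it stays positive until it meets
  its own simple reflection, and multiplying by the reflection in \<beta> deletes that
  letter.\<close>

lemma word_exchange:
  "word k w \<Longrightarrow> \<beta> \<in> P \<Longrightarrow> transpose w *v \<beta> \<notin> P \<Longrightarrow> \<exists>j<k. word j (reflection \<beta> ** w)"
proof (induction arbitrary: \<beta> rule: word.induct)
  case word_one then show ?case by (simp add: transpose_mat)
next
  case (word_Suc \<gamma> k w)
  have \<gamma>r: "\<gamma> \<in> roots W" using word_Suc.hyps \<Delta>_root by blast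
  show ?case
  proof (cases "\<beta> = \<gamma>")
    case True
    then show ?thesis using word_Suc.hyps by (auto simp: reflection_cancel[OF \<gamma>r])
  next
    case False
    let ?\<beta>' = "reflection \<gamma> *v \<beta>"
    have P': "?\<beta>' \<in> P" using False word_Suc simple_reflection_P by blast
    have "transpose w *v ?\<beta>' \<notin> P"
      using word_Suc.prems(2) by (simp add: matrix_transpose_mul transpose_reflection matrix_vector_mul_assoc)
    then obtain j where j: "j < k" "word j (reflection ?\<beta>' ** w)" using word_Suc.IH[OF P'] by blast
    have "reflection ?\<beta>' = reflection \<gamma> ** reflection \<beta> ** reflection \<gamma>"
      using W_conj[OF root_W[OF \<gamma>r], of \<beta>] by (simp add: transpose_reflection)
    then have "reflection \<gamma> ** (reflection ?\<beta>' ** w) = reflection \<beta> ** (reflection \<gamma> ** w)"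
      by (simp add: reflection_cancel[OF \<gamma>r] flip: matrix_mul_assoc)
    then have "word (Suc j) (reflection \<beta> ** (reflection \<gamma> ** w))"
      using word.word_Suc[OF word_Suc.hyps(1) j(2)] by simp
    then show ?thesis using j(1) by blast
  qed
qed

section \<open>Length, descents and folding towards the fundamental chamber\<close>

definition len :: "real^'n^'n \<Rightarrow> nat" where "len w = (LEAST k. word k w)"

lemma word_len: "w \<in> W \<Longrightarrow> word (len w) w"
  unfolding len_def using W_word by (auto intro: LeastI_ex)

lemma len_le: "word k w \<Longrightarrow> len w \<le> k"
  unfolding len_def by (rule Least_le)

lemma len_reflection_less:
  assumes "w \<in> W" "\<beta> \<in> P" "transpose w *v \<beta> \<notin> P"
  shows "len (reflection \<beta> ** w) < len w"
  using word_exchange[OF word_len[OF assms(1)] assms(2,3)] len_le by (meson le_less_trans)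

text \<open>The first letter \<alpha> of a shortest word is a descent: if w^-1 \<alpha> were
  positive, then the shorter element \<open>v = reflection \<alpha> ** w\<close> would send \<alpha>
  under its inverse to a negative root, and \<open>w\<close> would be shorter than
  \<open>v\<close>.\<close>

lemma descent_exists:
  assumes "w \<in> W" "w \<noteq> mat 1"
  shows "\<exists>\<alpha>\<in>\<Delta>. transpose w *v \<alpha> \<notin> P"
  using word_len[OF assms(1)]
proof cases
  case word_one
  then show ?thesis using assms by simp
next
  case (word_Suc \<alpha> k v)
  have vW: "v \<in> W" using word_Suc word_W by blast
  have \<alpha>r: "\<alpha> \<in> roots W" using word_Suc \<Delta>_root by blast
  have v: "reflection \<alpha> ** w = v" using word_Suc by (simp add: reflection_cancel[OF \<alpha>r])
  have "transpose w *v \<alpha> \<notin> P"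
  proof
    assume "transpose w *v \<alpha> \<in> P"
    moreover have "transpose w *v \<alpha> = - (transpose v *v \<alpha>)"
      using word_Suc(2) \<alpha>r root_nz
      by (simp add: matrix_transpose_mul transpose_reflection reflection_self
          linear_neg[OF matrix_vector_mul_linear] flip: matrix_vector_mul_assoc)
    ultimately have "transpose v *v \<alpha> \<notin> P" using P_disj by fastforce
    then have "len (reflection \<alpha> ** v) < len v"
      using len_reflection_less[OF vW] word_Suc \<Delta>_in_P by blast
    moreover have "len v \<le> k" using word_Suc len_le by blast
    ultimately show False using word_Suc by simp
  qed
  then show ?thesis using word_Suc by blast
qed

text \<open>As \<open>transpose w\<close> is the inverse of \<open>w\<close>, the condition says
  that the chamber of \<open>w\<close> is on the same side of the hyperplane of \<alpha> as the
  fundamental chamber.\<close>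

definition chamber_fold :: "real^'n \<Rightarrow> real^'n^'n \<Rightarrow> real^'n^'n" where
  "chamber_fold \<alpha> w = (if transpose w *v \<alpha> \<in> P then w else reflection \<alpha> ** w)"

lemma chamber_fold_W: "\<alpha> \<in> \<Delta> \<Longrightarrow> w \<in> W \<Longrightarrow> chamber_fold \<alpha> w \<in> W"
  by (simp add: chamber_fold_def mult_W root_W \<Delta>_root)

lemma len_chamber_fold: "\<alpha> \<in> \<Delta> \<Longrightarrow> w \<in> W \<Longrightarrow> len (chamber_fold \<alpha> w) \<le> len w"
  using len_reflection_less[of w \<alpha>] \<Delta>_in_P by (auto simp: chamber_fold_def)

lemma foldr_chamber_fold_W: "set \<alpha>s \<subseteq> \<Delta> \<Longrightarrow> w \<in> W \<Longrightarrow> foldr chamber_fold \<alpha>s w \<in> W"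
  by (induction \<alpha>s) (auto intro: chamber_fold_W)

text \<open>Choose the list that minimises the total length of all images. Simple folds lengthen
  nothing, and an image other than the identity has a descent whose fold shortens it strictly. The
  extra fold goes to the head, which \<open>foldr\<close> applies last.\<close>

lemma constant_chamber_fold:
  "\<exists>\<alpha>s. set \<alpha>s \<subseteq> \<Delta> \<and> (\<forall>w\<in>W. foldr chamber_fold \<alpha>s w = mat 1)"
proof -
  define N where "N \<alpha>s = (\<Sum>w\<in>W. len (foldr chamber_fold \<alpha>s w))" for \<alpha>s
  obtain \<alpha>s where \<alpha>s: "set \<alpha>s \<subseteq> \<Delta>" and min: "\<And>\<beta>s. set \<beta>s \<subseteq> \<Delta> \<Longrightarrow> N \<alpha>s \<le> N \<beta>s"
    using ex_has_least_nat[of "\<lambda>\<alpha>s. set \<alpha>s \<subseteq> \<Delta>" "[]" N] by auto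
  have "foldr chamber_fold \<alpha>s w = mat 1" if w: "w \<in> W" for w
  proof (rule ccontr)
    let ?u = "foldr chamber_fold \<alpha>s w"
    assume "?u \<noteq> mat 1"
    then obtain \<alpha> where \<alpha>: "\<alpha> \<in> \<Delta>" "transpose ?u *v \<alpha> \<notin> P"
      using descent_exists foldr_chamber_fold_W[OF \<alpha>s w] by blast
    have "len (chamber_fold \<alpha> ?u) < len ?u"
      using len_reflection_less[of ?u \<alpha>] foldr_chamber_fold_W[OF \<alpha>s w] \<alpha> \<Delta>_in_P
      by (simp add: chamber_fold_def)
    then have "N (\<alpha> # \<alpha>s) < N \<alpha>s"
      unfolding N_def using w finite_W len_chamber_fold[OF \<alpha>(1)] foldr_chamber_fold_W[OF \<alpha>s]
      by (intro sum_strict_mono_ex1) auto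
    then show False using min[of "\<alpha> # \<alpha>s"] \<alpha>(1) \<alpha>s by simp
  qed
  then show ?thesis using \<alpha>s by blast
qed

end

section \<open>Parabolic subgroups and the walls of simple reflections\<close>

context simple_roots
begin

abbreviation G where "G \<equiv> GL\<lparr>carrier := W\<rparr>"

lemma group_G: "group G"
  using subgroup_W group_GL by (rule subgroup.subgroup_is_group)

lemma G_simps: "carrier G = W" "v \<otimes>\<^bsub>G\<^esub> w = v ** w" "\<one>\<^bsub>G\<^esub> = mat 1"
  by (simp_all add: GL_def)

lemma G_inv_reflection: "\<alpha> \<in> roots W \<Longrightarrow> inv\<^bsub>G\<^esub> (reflection \<alpha>) = reflection \<alpha>"
  by (rule group.inv_equality[OF group_G])
    (simp_all add: GL_def reflection_involution root_nz root_W)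

lemma simple_reflections_subset: "reflection ` \<Delta> \<subseteq> W"
  using \<Delta>_root root_W by blast

text \<open>Geometrically, a positive root whose reflection is not in the parabolic subgroup is positive on
  the face that the subgroup fixes.\<close>

lemma parabolic_preserves_positive:
  assumes S: "S \<subseteq> reflection ` \<Delta>" and "h \<in> generate G S"
  shows "\<forall>\<gamma>\<in>P. reflection \<gamma> \<notin> generate G S \<longrightarrow>
    transpose h *v \<gamma> \<in> P \<and> reflection (transpose h *v \<gamma>) \<notin> generate G S"
proof -
  have gen: "v ** w \<in> generate G S" if "v \<in> generate G S" "w \<in> generate G S" for v w
    using generate.eng[OF that] by (simp only: G_simps)
  \<comment> \<open>The root \<gamma> differs from \<delta> because its reflection lies outside the
    subgroup, so it stays positive; conjugation by an element of the subgroup keeps its reflection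
    outside. Both claims are carried along so that they compose in products.\<close>
  have simple: "reflection \<delta> *v \<gamma> \<in> P \<and> reflection (reflection \<delta> *v \<gamma>) \<notin> generate G S"
    if \<delta>: "\<delta> \<in> \<Delta>" "reflection \<delta> \<in> generate G S" and \<gamma>: "\<gamma> \<in> P" "reflection \<gamma> \<notin> generate G S" for \<delta> \<gamma>
  proof
    show "reflection \<delta> *v \<gamma> \<in> P" using simple_reflection_P[OF \<delta>(1) \<gamma>(1)] \<gamma>(2) \<delta>(2) by blast
    have \<delta>r: "\<delta> \<in> roots W" using \<delta> \<Delta>_root by blast
    have "reflection \<gamma> = reflection \<delta> ** reflection (reflection \<delta> *v \<gamma>) ** reflection \<delta>"
      unfolding W_conj[OF root_W[OF \<delta>r], symmetric]
      by (simp add: reflection_cancel[OF \<delta>r] reflection_involution[OF root_nz[OF \<delta>r]]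
          transpose_reflection flip: matrix_mul_assoc)
    then show "reflection (reflection \<delta> *v \<gamma>) \<notin> generate G S"
      using gen \<delta>(2) \<gamma>(2) by metis
  qed
  show ?thesis
    using assms(2)
  proof (induction rule: generate.induct)
    case one then show ?case by (simp add: GL_def transpose_mat)
  next
    case (incl h)
    then obtain \<delta> where \<delta>: "\<delta> \<in> \<Delta>" "h = reflection \<delta>" using S by blast
    have "reflection \<delta> \<in> generate G S" using generate.incl[OF incl] \<delta>(2) by metis
    then show ?case using simple[OF \<delta>(1)] \<delta>(2) by (simp add: transpose_reflection)
  next
    case (inv h)
    then obtain \<delta> where \<delta>: "\<delta> \<in> \<Delta>" "h = reflection \<delta>" using S by blast
    then have "inv\<^bsub>G\<^esub> h = h" using G_inv_reflection \<Delta>_root by blast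
    moreover have "reflection \<delta> \<in> generate G S" using generate.incl[OF inv] \<delta>(2) by metis
    ultimately show ?case using simple[OF \<delta>(1)] \<delta>(2) by (simp only: transpose_reflection) blast
  next
    case (eng h1 h2)
    then show ?case
      by (simp add: GL_def matrix_transpose_mul flip: matrix_vector_mul_assoc)
  qed
qed

text \<open>With \<open>r\<close> the reflection in \<open>transpose w *v \<alpha>\<close> one has
  \<open>reflection \<alpha> ** w = w ** r\<close>. If \<open>r\<close> lies in the subgroup, the
  coset of \<open>w\<close> is fixed; if not, no element of the subgroup changes the sign of that
  root.\<close>

lemma wall_simple_reflection:
  assumes S: "S \<subseteq> reflection ` \<Delta>" and \<alpha>: "\<alpha> \<in> \<Delta>"
  shows "wall G (generate G S) (reflection \<alpha>, \<lambda>w. transpose w *v \<alpha> \<in> P)"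
proof -
  interpret G: group G by (rule group_G)
  let ?H = "generate G S"
  have "S \<subseteq> carrier G" using S simple_reflections_subset by auto
  then have H: "subgroup ?H G" by (rule G.generate_is_subgroup)
  have HW: "?H \<subseteq> W" using subgroup.subset[OF H] by simp
  have \<alpha>r: "\<alpha> \<in> roots W" using \<alpha> \<Delta>_root by blast
  have root: "transpose w *v \<alpha> \<in> roots W" if "w \<in> W" for w
    using that \<alpha>r transpose_W W_root by blast
  have neg: "transpose (reflection \<alpha> ** w) *v \<alpha> \<in> P \<longleftrightarrow> transpose w *v \<alpha> \<notin> P" if w: "w \<in> W" for w
  proof -
    have "transpose (reflection \<alpha> ** w) *v \<alpha> = - (transpose w *v \<alpha>)"
      using \<alpha>r root_nz
      by (simp add: matrix_transpose_mul transpose_reflection reflection_self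
          linear_neg[OF matrix_vector_mul_linear] flip: matrix_vector_mul_assoc)
    then show ?thesis using not_P_iff[OF root[OF w]] by simp
  qed
  have "(reflection \<alpha> ** w) <#\<^bsub>G\<^esub> ?H = w <#\<^bsub>G\<^esub> ?H \<or>
      (\<forall>h\<in>?H. transpose (w ** h) *v \<alpha> \<in> P \<longleftrightarrow> transpose w *v \<alpha> \<in> P)" if w: "w \<in> W" for w
  proof (cases "reflection (transpose w *v \<alpha>) \<in> ?H")
    case True
    let ?r = "reflection (transpose w *v \<alpha>)"
    have "w ** ?r = reflection \<alpha> ** w"
      using W_conj[OF transpose_W[OF w], of \<alpha>] W_cancel[OF w]
      by (metis matrix_mul_assoc matrix_mul_lid transpose_transpose)
    moreover have "(w ** ?r) <#\<^bsub>G\<^esub> ?H = w <#\<^bsub>G\<^esub> (?r <#\<^bsub>G\<^esub> ?H)"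
      by (rule G.lcos_m_assoc[of ?H w ?r, unfolded G_simps(2), symmetric]) (use w True HW in auto)
    moreover have "?r <#\<^bsub>G\<^esub> ?H = ?H"
      using True H HW by (intro G.coset_join3) auto
    ultimately show ?thesis by simp
  next
    case False
    let ?\<beta> = "transpose w *v \<alpha>"
    have "transpose (w ** h) *v \<alpha> \<in> P \<longleftrightarrow> ?\<beta> \<in> P" if h: "h \<in> ?H" for h
    proof -
      have th: "transpose (w ** h) *v \<alpha> = transpose h *v ?\<beta>"
        by (simp add: matrix_transpose_mul flip: matrix_vector_mul_assoc)
      have pres: "transpose h *v \<gamma> \<in> P" if "\<gamma> \<in> P" "reflection \<gamma> \<notin> ?H" for \<gamma>
        using parabolic_preserves_positive[OF S h] that by blast
      show ?thesis
      proof (cases "?\<beta> \<in> P")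
        case True
        then show ?thesis using pres[of ?\<beta>] False th by simp
      next
        case neg: False
        then have "- ?\<beta> \<in> P" using not_P_iff[OF root[OF w]] by simp
        then have "transpose h *v (- ?\<beta>) \<in> P" using pres False by (simp add: reflection_uminus)
        then have "- (transpose h *v ?\<beta>) \<in> P" by (simp add: linear_neg[OF matrix_vector_mul_linear])
        then have "transpose h *v ?\<beta> \<notin> P" using P_disj by blast
        then show ?thesis using neg th by simp
      qed
    qed
    then show ?thesis by blast
  qed
  then show ?thesis
    unfolding wall_def using neg \<alpha>r by (simp add: GL_def root_W reflection_involution root_nz)
qed

lemma weakly_norming_reflection_graph:
  assumes S: "S1 \<subseteq> reflection ` \<Delta>" "S2 \<subseteq> reflection ` \<Delta>"
  shows "weakly_norming (reflection_graph W S1 S2)"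
proof -
  interpret G: group G by (rule group_G)
  let ?H1 = "generate G S1" and ?H2 = "generate G S2"
  have graph: "reflection_graph W S1 S2 = coset_graph G ?H1 ?H2"
    by (simp add: reflection_graph_def coset_graph_def Let_def)
  have H: "subgroup ?H1 G" "subgroup ?H2 G"
    using S[THEN subset_trans, OF simple_reflections_subset] by (auto intro!: G.generate_is_subgroup)
  obtain \<alpha>s where \<alpha>s: "set \<alpha>s \<subseteq> \<Delta>" "\<forall>w\<in>W. foldr chamber_fold \<alpha>s w = mat 1"
    using constant_chamber_fold by blast
  define a where "a \<alpha> = (reflection \<alpha>, \<lambda>w :: real^'n^'n. transpose w *v \<alpha> \<in> P)" for \<alpha>
  have fold: "fold_across G (a \<alpha>) = chamber_fold \<alpha>" for \<alpha>
    by (simp add: fun_eq_iff fold_across_def a_def chamber_fold_def GL_def)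
  have foldr: "foldr (fold_across G) (map a \<alpha>s) = foldr chamber_fold \<alpha>s"
    by (induction \<alpha>s) (simp_all add: fold)
  have Hoelder: "edge_Hoelder unit_lborel (vertex_set (coset_graph G ?H1 ?H2)) (edge_set (coset_graph G ?H1 ?H2))
      (\<lambda>e. Inl (fst e)) (\<lambda>e. Inr (snd e))"
  proof (rule G.edge_Hoelder_coset_graph[OF prob_space_unit_lborel _ H])
    show "finite (carrier G)" using finite_W by simp
    show "wall G ?H1 b" "wall G ?H2 b" if "b \<in> set (map a \<alpha>s)" for b
      using that \<alpha>s(1) wall_simple_reflection S by (auto simp: a_def)
    show "foldr (fold_across G) (map a \<alpha>s) w = \<one>\<^bsub>G\<^esub>" if "w \<in> carrier G" for w
      using that \<alpha>s(2) unfolding foldr G_simps by blast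
  qed
  show ?thesis
    unfolding graph
  proof (rule weakly_norming_if_edge_Hoelder[OF _ _ Hoelder])
    show "finite_bigraph (coset_graph G ?H1 ?H2)"
      using finite_W by (auto simp: finite_bigraph_def coset_graph_def LCOSETS_def)
    show "edge_set (coset_graph G ?H1 ?H2) \<noteq> {}"
      using one_W by (auto simp: coset_graph_def)
  qed
qed

end

text \<open>Irredundancy is minimality in another form: if \<alpha> were a non-negative combination
  of the other elements of \<open>\<Delta>\<close>, substituting it into every expansion would make
  \<open>\<Delta> - {\<alpha>}\<close> generating.\<close>

lemma simple_roots_positive_roots:
  assumes W: "finite_reflection_group W" and u: "ordered_basis u"
    and gen: "nonneg_generating (positive_roots u W) \<Delta>"
    and min: "\<And>\<Delta>'. \<Delta>' \<subset> \<Delta> \<Longrightarrow> \<not> nonneg_generating (positive_roots u W) \<Delta>'"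
  shows "simple_roots W (positive_roots u W) \<Delta>"
proof
  let ?P = "positive_roots u W"
  have P: "\<alpha> \<in> ?P \<longleftrightarrow> \<alpha> \<in> roots W \<and> lex_positive u \<alpha>" for \<alpha>
    by (simp add: positive_roots_def)
  have \<Delta>P: "\<Delta> \<subseteq> ?P" using gen by (simp add: nonneg_generating_def)
  have "finite W" using W by (simp add: finite_reflection_group_def)
  moreover have "\<Delta> \<subseteq> roots W" using \<Delta>P P by blast
  ultimately have fin: "finite \<Delta>" by (metis finite_roots finite_subset)
  show "finite_reflection_group W" "\<Delta> \<subseteq> ?P" by fact+
  show "?P \<subseteq> roots W" using P by blast
  show "\<alpha> \<in> ?P \<or> - \<alpha> \<in> ?P" if "\<alpha> \<in> roots W" for \<alpha>
  proof -
    have "\<alpha> \<noteq> 0" using that by (auto simp: roots_def)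
    then show ?thesis
      using that lex_positive_total[OF u, of \<alpha>] by (auto simp: P roots_def reflection_uminus)
  qed
  show "- \<alpha> \<notin> ?P" if "\<alpha> \<in> ?P" for \<alpha>
    using that lex_positive_add[of u \<alpha> "- \<alpha>"] not_lex_positive_0[OF u] by (auto simp: P)
  show "\<exists>a. (\<forall>\<alpha>\<in>\<Delta>. 0 \<le> a \<alpha>) \<and> \<beta> = (\<Sum>\<alpha>\<in>\<Delta>. a \<alpha> *\<^sub>R \<alpha>)" if "\<beta> \<in> ?P" for \<beta>
    using gen that by (simp add: nonneg_generating_def)
  show "a \<alpha> = 0" if "\<forall>\<alpha>\<in>\<Delta>. 0 \<le> a \<alpha>" "(\<Sum>\<alpha>\<in>\<Delta>. a \<alpha> *\<^sub>R \<alpha>) = 0" "\<alpha> \<in> \<Delta>" for a \<alpha>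
  proof -
    have "(\<forall>\<alpha>\<in>\<Delta>. a \<alpha> = 0) \<or> lex_positive u (\<Sum>\<alpha>\<in>\<Delta>. a \<alpha> *\<^sub>R \<alpha>)"
    proof (rule lex_positive_sum[OF fin])
      show "lex_positive u \<gamma>" if "\<gamma> \<in> \<Delta>" for \<gamma>
        using subsetD[OF \<Delta>P that] P by simp
    qed (use that(1) in blast)
    then show ?thesis
      unfolding that(2) using not_lex_positive_0[OF u] that(3) by blast
  qed
  show "\<alpha> \<noteq> (\<Sum>\<gamma>\<in>\<Delta> - {\<alpha>}. a \<gamma> *\<^sub>R \<gamma>)" if \<alpha>: "\<alpha> \<in> \<Delta>" and a: "\<forall>\<gamma>\<in>\<Delta> - {\<alpha>}. 0 \<le> a \<gamma>" for a \<alpha>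
  proof
    assume eq: "\<alpha> = (\<Sum>\<gamma>\<in>\<Delta> - {\<alpha>}. a \<gamma> *\<^sub>R \<gamma>)"
    have "\<exists>c. (\<forall>\<gamma>\<in>\<Delta> - {\<alpha>}. 0 \<le> c \<gamma>) \<and> \<beta> = (\<Sum>\<gamma>\<in>\<Delta> - {\<alpha>}. c \<gamma> *\<^sub>R \<gamma>)" if \<beta>: "\<beta> \<in> ?P" for \<beta>
    proof -
      obtain b where b: "\<forall>\<gamma>\<in>\<Delta>. 0 \<le> b \<gamma>" "\<beta> = (\<Sum>\<gamma>\<in>\<Delta>. b \<gamma> *\<^sub>R \<gamma>)"
        using gen \<beta> unfolding nonneg_generating_def by blast
      have "\<beta> = b \<alpha> *\<^sub>R \<alpha> + (\<Sum>\<gamma>\<in>\<Delta> - {\<alpha>}. b \<gamma> *\<^sub>R \<gamma>)"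
        unfolding b(2) by (rule sum.remove[OF fin \<alpha>])
      also have "b \<alpha> *\<^sub>R \<alpha> = (\<Sum>\<gamma>\<in>\<Delta> - {\<alpha>}. (b \<alpha> * a \<gamma>) *\<^sub>R \<gamma>)"
        using arg_cong[OF eq, of "scaleR (b \<alpha>)"] by (simp only: scaleR_sum_right scaleR_scaleR)
      finally have "\<beta> = (\<Sum>\<gamma>\<in>\<Delta> - {\<alpha>}. (b \<alpha> * a \<gamma> + b \<gamma>) *\<^sub>R \<gamma>)"
        by (simp add: scaleR_add_left sum.distrib)
      moreover have "\<forall>\<gamma>\<in>\<Delta> - {\<alpha>}. 0 \<le> b \<alpha> * a \<gamma> + b \<gamma>"
        using a b(1) \<alpha> by (auto intro!: add_nonneg_nonneg mult_nonneg_nonneg)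
      ultimately show ?thesis by (intro exI[of _ "\<lambda>\<gamma>. b \<alpha> * a \<gamma> + b \<gamma>"] conjI)
    qed
    then have "nonneg_generating ?P (\<Delta> - {\<alpha>})"
      using \<Delta>P by (auto simp: nonneg_generating_def)
    moreover have "\<Delta> - {\<alpha>} \<subset> \<Delta>" using \<alpha> by blast
    ultimately show False using min by blast
  qed
qed

theorem theorem1p2:
  fixes W S S1 S2 :: "(real ^ 'n ^ 'n) set"
  assumes "finite_reflection_group W"
    and "simple_reflections W S"
    and "S1 \<subseteq> S" and "S2 \<subseteq> S"
  shows "weakly_norming (reflection_graph W S1 S2)"
proof -
  obtain \<Delta> u where \<Delta>: "S = reflection ` \<Delta>" "ordered_basis u"
    "nonneg_generating (positive_roots u W) \<Delta>"
    "\<forall>\<Delta>'. \<Delta>' \<subset> \<Delta> \<longrightarrow> \<not> nonneg_generating (positive_roots u W) \<Delta>'"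
    using assms(2) by (auto simp: simple_reflections_def simple_system_def)
  interpret simple_roots W "positive_roots u W" \<Delta>
    using assms(1) \<Delta> by (intro simple_roots_positive_roots) auto
  show ?thesis
    using assms(3,4) \<Delta>(1) by (intro weakly_norming_reflection_graph) auto
qed

end
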